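(* Let $\Omega\subset\mathbb R^N$ be a bounded Lipschitz domain, $s\in(0,1)$, $t>0$, $A_s=I+(-\Delta)^s$, $B=e^{-tA_s}A_s^{-1/2}$, and let $u^\dagger\in H_0^s(\Omega)$. Let $\{e_j\}_{j\ge1}$ be an orthonormal basis of $L^2(\Omega)$ with $A_se_j=\lambda_je_j$, $1\le\lambda_1\le\lambda_2\le\cdots\to\infty$, and write $u^\dagger=\sum_ju_je_j$. Let $\beta\in(0,1]$ and $w=\sum_jw_je_j\in L^2(\Omega)$. The source condition $A_s^{1/2}u^\dagger=(B^*B)^\beta w$ holds if and only if $$u_j=\lambda_j^{-\left(\beta+\frac12\right)}e^{-2\beta t\lambda_j}w_j,\qquad j=1,2,\dots,$$ where $\{w_j\}_{j\ge1}\in\ell^2$ with $\sum_jw_j^2=\|w\|_{L^2(\Omega)}^2$.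
   Context: All spaces are real. $H_0^s(\Omega)$ is the space of functions $u\in H^s(\mathbb R^N)$ with $u=0$ a.e. in $\mathbb R^N\setminus\Omega$ (also regarded as functions on $\Omega$). On it consider the closed, symmetric, coercive bilinear form $$a_s(u,v)=\int_\Omega uv\,dx+\frac{C_{N,s}}{2}\iint_{\mathbb R^{2N}}\frac{(u(x)-u(y))(v(x)-v(y))}{|x-y|^{N+2s}}\,dx\,dy,$$ where $C_{N,s}>0$ is the standard normalization constant of the integral fractional Laplacian, $C_{N,s}=\frac{4^s s\,\Gamma(N/2+s)}{\pi^{N/2}\Gamma(1-s)}$. $A_s=I+(-\Delta)^s$ is the unique positive self-adjoint operator on $L^2(\Omega)$ associated with $a_s$, with $D(A_s^{1/2})=H_0^s(\Omega)$; powers and $e^{-tA_s}$ are defined by the spectral theorem. $A_s$ has compact resolvent, so an eigenbasis as in the claim exists. *)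

theory Defs
  imports "HOL-Analysis.Analysis"
begin

section \<open>The real Hilbert space of square-integrable functions\<close>

definition square_integrable :: "('a::euclidean_space \<Rightarrow> real) \<Rightarrow> bool" where
  "square_integrable f \<longleftrightarrow>
     f \<in> borel_measurable lborel \<and> integrable lborel (\<lambda>x. (f x)\<^sup>2)"

lemma square_integrable_zero: "square_integrable (\<lambda>x. 0)"
  by (simp add: square_integrable_def)

lemma square_integrable_mult:
  assumes "square_integrable f" "square_integrable g"
  shows "integrable lborel (\<lambda>x. f x * g x)"
proof (rule Bochner_Integration.integrable_bound)
  show "integrable lborel (\<lambda>x. (f x)\<^sup>2 + (g x)\<^sup>2)"
    using assms by (auto simp: square_integrable_def)
  show "(\<lambda>x. f x * g x) \<in> borel_measurable lborel"
    using assms by (auto simp: square_integrable_def)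
  have "\<bar>a * b\<bar> \<le> a\<^sup>2 + b\<^sup>2" for a b :: real
  proof -
    have "2 * \<bar>a * b\<bar> \<le> a\<^sup>2 + b\<^sup>2"
      using sum_squares_bound[of "\<bar>a\<bar>" "\<bar>b\<bar>"] by (simp add: abs_mult)
    then show ?thesis by linarith
  qed
  then show "AE x in lborel. norm (f x * g x) \<le> norm ((f x)\<^sup>2 + (g x)\<^sup>2)"
    by simp
qed

lemma square_integrable_add:
  assumes "square_integrable f" "square_integrable g"
  shows "square_integrable (\<lambda>x. f x + g x)"
  using assms square_integrable_mult[OF assms]
  by (auto simp: square_integrable_def power2_sum mult.assoc)

lemma square_integrable_scale:
  "square_integrable f \<Longrightarrow> square_integrable (\<lambda>x. c * f x)"
  by (auto simp: square_integrable_def power_mult_distrib)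

definition l2_eq :: "('a::euclidean_space \<Rightarrow> real) \<Rightarrow> ('a \<Rightarrow> real) \<Rightarrow> bool" where
  "l2_eq f g \<longleftrightarrow>
     square_integrable f \<and> square_integrable g \<and> (AE x in lborel. f x = g x)"

quotient_type (overloaded) 'a L2 = "('a::euclidean_space) \<Rightarrow> real" / partial: l2_eq
proof (rule part_equivpI)
  show "\<exists>f :: 'a \<Rightarrow> real. l2_eq f f"
    using square_integrable_zero by (auto simp: l2_eq_def)
  show "symp (l2_eq :: ('a \<Rightarrow> real) \<Rightarrow> _)"
    by (auto simp: symp_def l2_eq_def)
  show "transp (l2_eq :: ('a \<Rightarrow> real) \<Rightarrow> _)"
    by (auto simp: transp_def l2_eq_def)
qed

text \<open>A representative of the class; every use below is invariant under a.e. modification.\<close>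
definition fun_of :: "'a::euclidean_space L2 \<Rightarrow> 'a \<Rightarrow> real" where
  "fun_of u = rep_L2 u"

instantiation L2 :: (euclidean_space) real_inner
begin

lift_definition zero_L2 :: "'a L2" is "\<lambda>x. 0"
  by (simp add: l2_eq_def square_integrable_zero)

lift_definition plus_L2 :: "'a L2 \<Rightarrow> 'a L2 \<Rightarrow> 'a L2" is "\<lambda>f g x. f x + g x"
  by (auto simp: l2_eq_def square_integrable_add)

lift_definition scaleR_L2 :: "real \<Rightarrow> 'a L2 \<Rightarrow> 'a L2" is "\<lambda>c f x. c * f x"
  by (auto simp: l2_eq_def square_integrable_scale)

lift_definition uminus_L2 :: "'a L2 \<Rightarrow> 'a L2" is "\<lambda>f x. - f x"
  using square_integrable_scale[of _ "-1"] by (auto simp: l2_eq_def)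

lift_definition inner_L2 :: "'a L2 \<Rightarrow> 'a L2 \<Rightarrow> real" is
  "\<lambda>f g. LINT x|lborel. f x * g x"
proof -
  fix f f' g g' :: "'a \<Rightarrow> real"
  assume f: "l2_eq f f'" and g: "l2_eq g g'"
  then have "AE x in lborel. f x * g x = f' x * g' x"
    by (auto simp: l2_eq_def elim: AE_mp)
  then show "(LINT x|lborel. f x * g x) = (LINT x|lborel. f' x * g' x)"
    using f g by (intro integral_cong_AE) (auto simp: l2_eq_def square_integrable_def)
qed

definition minus_L2 :: "'a L2 \<Rightarrow> 'a L2 \<Rightarrow> 'a L2" where
  "u - v = u + (- v :: 'a L2)"

definition norm_L2 :: "'a L2 \<Rightarrow> real" where
  "norm u = sqrt (inner u u)" for u :: "'a L2"

definition sgn_L2 :: "'a L2 \<Rightarrow> 'a L2" where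
  "sgn u = inverse (norm u) *\<^sub>R u" for u :: "'a L2"

definition dist_L2 :: "'a L2 \<Rightarrow> 'a L2 \<Rightarrow> real" where
  "dist u v = norm (u - v)" for u v :: "'a L2"

definition uniformity_L2 :: "('a L2 \<times> 'a L2) filter" where
  "uniformity_L2 = (INF e\<in>{0<..}. principal {(u :: 'a L2, v). dist u v < e})"

definition open_L2 :: "'a L2 set \<Rightarrow> bool" where
  "open_L2 U \<longleftrightarrow> (\<forall>u\<in>U. eventually (\<lambda>(u', v). u' = u \<longrightarrow> v \<in> U) uniformity)"

instance
proof
  fix u v w :: "'a L2" and a b :: real and U :: "'a L2 set"
  show "u + v + w = u + (v + w)"
    by transfer (auto simp: l2_eq_def add.assoc intro!: square_integrable_add)
  show "u + v = v + u"
    by transfer (auto simp: l2_eq_def add.commute intro!: square_integrable_add)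
  show "0 + u = u"
    by transfer (auto simp: l2_eq_def)
  show "- u + u = 0"
    by transfer (auto simp: l2_eq_def square_integrable_zero)
  show "u - v = u + - v"
    by (rule minus_L2_def)
  show "a *\<^sub>R (u + v) = a *\<^sub>R u + a *\<^sub>R v"
    by transfer (auto simp: l2_eq_def distrib_left
        intro!: square_integrable_add square_integrable_scale)
  show "(a + b) *\<^sub>R u = a *\<^sub>R u + b *\<^sub>R u"
    by transfer (auto simp: l2_eq_def distrib_right
        intro!: square_integrable_add square_integrable_scale)
  show "a *\<^sub>R b *\<^sub>R u = (a * b) *\<^sub>R u"
    by transfer (auto simp: l2_eq_def mult.assoc intro!: square_integrable_scale)
  show "1 *\<^sub>R u = u"
    by transfer (auto simp: l2_eq_def)
  show "dist u v = norm (u - v)"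
    by (rule dist_L2_def)
  show "sgn u = inverse (norm u) *\<^sub>R u"
    by (rule sgn_L2_def)
  show "norm u = sqrt (inner u u)"
    by (rule norm_L2_def)
  show "uniformity = (INF e\<in>{0<..}. principal {(u :: 'a L2, v). dist u v < e})"
    by (rule uniformity_L2_def)
  show "open U \<longleftrightarrow> (\<forall>u\<in>U. eventually (\<lambda>(u', v). u' = u \<longrightarrow> v \<in> U) uniformity)"
    by (rule open_L2_def)
  show "inner u v = inner v u"
    by transfer (simp add: mult.commute)
  show "inner (u + v) w = inner u w + inner v w"
    by transfer (auto simp: l2_eq_def distrib_right square_integrable_mult)
  show "inner (a *\<^sub>R u) v = a * inner u v"
    by transfer (simp add: mult.assoc)
  show "0 \<le> inner u u"
    by transfer simp
  show "inner u u = 0 \<longleftrightarrow> u = 0"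
  proof transfer
    fix f :: "'a \<Rightarrow> real"
    assume f: "l2_eq f f"
    then have "integrable lborel (\<lambda>x. f x * f x)"
      by (simp add: l2_eq_def square_integrable_mult)
    then have "(LINT x|lborel. f x * f x) = 0 \<longleftrightarrow> (AE x in lborel. f x * f x = 0)"
      by (intro integral_nonneg_eq_0_iff_AE) auto
    then show "(LINT x|lborel. f x * f x) = 0 \<longleftrightarrow> l2_eq f (\<lambda>x. 0)"
      using f by (auto simp: l2_eq_def square_integrable_zero)
  qed
qed

end

text \<open>\<open>L\<^sup>2(\<Omega>)\<close>, its elements being extended by zero to the whole space.\<close>
definition L2_on :: "'a::euclidean_space set \<Rightarrow> 'a L2 set" where
  "L2_on \<Omega> = {u. AE x in lborel. x \<notin> \<Omega> \<longrightarrow> fun_of u x = 0}"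


section \<open>Bounded Lipschitz domains\<close>

text \<open>Near each boundary point, \<open>\<Omega>\<close> is the region strictly above the graph of a Lipschitz
  function on the hyperplane orthogonal to a unit vector \<open>\<nu>\<close>.\<close>
definition bounded_lipschitz_domain :: "'a::euclidean_space set \<Rightarrow> bool" where
  "bounded_lipschitz_domain \<Omega> \<longleftrightarrow>
     \<Omega> \<noteq> {} \<and> open \<Omega> \<and> connected \<Omega> \<and> bounded \<Omega> \<and>
     (\<forall>p\<in>frontier \<Omega>. \<exists>r>0. \<exists>\<nu> \<gamma> L. norm \<nu> = 1 \<and> L-lipschitz_on {y. y \<bullet> \<nu> = 0} \<gamma> \<and>
        \<Omega> \<inter> ball p r = {x \<in> ball p r. \<gamma> (x - (x \<bullet> \<nu>) *\<^sub>R \<nu>) < x \<bullet> \<nu>})"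


section \<open>Fractional Sobolev spaces and the form of \<open>I + (-\<Delta>)\<^sup>s\<close>\<close>

definition sobolev :: "real \<Rightarrow> 'a::euclidean_space L2 set" where
  "sobolev s = {u. integrable (lborel \<Otimes>\<^sub>M lborel)
     (\<lambda>(x, y). (fun_of u x - fun_of u y)\<^sup>2 / norm (x - y) powr (real DIM('a) + 2 * s))}"

definition sobolev0 :: "real \<Rightarrow> 'a::euclidean_space set \<Rightarrow> 'a L2 set" where
  "sobolev0 s \<Omega> = sobolev s \<inter> L2_on \<Omega>"

definition frac_laplacian_const :: "nat \<Rightarrow> real \<Rightarrow> real" where
  "frac_laplacian_const N s =
     4 powr s * s * Gamma (real N / 2 + s) / (pi powr (real N / 2) * Gamma (1 - s))"

definition frac_form ::
    "real \<Rightarrow> 'a::euclidean_space set \<Rightarrow> 'a L2 \<Rightarrow> 'a L2 \<Rightarrow> real" where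
  "frac_form s \<Omega> u v =
     (LINT x:\<Omega>|lborel. fun_of u x * fun_of v x) +
     frac_laplacian_const DIM('a) s / 2 *
       (LINT (x, y)|(lborel \<Otimes>\<^sub>M lborel).
          (fun_of u x - fun_of u y) * (fun_of v x - fun_of v y)
            / norm (x - y) powr (real DIM('a) + 2 * s))"


section \<open>Operators and functional calculus on a closed subspace of a real Hilbert space\<close>

text \<open>A (possibly unbounded) operator on the closed subspace \<open>H\<close> is represented by its graph
  \<open>T \<subseteq> H \<times> H\<close>, so \<open>(u, v) \<in> T\<close> means \<open>u \<in> D(T)\<close> and \<open>T u = v\<close>.
  In \<open>S O T\<close> the operator \<open>S\<close> is applied first.\<close>

definition form_operator ::
    "'h::real_inner set \<Rightarrow> 'h set \<Rightarrow> ('h \<Rightarrow> 'h \<Rightarrow> real) \<Rightarrow> ('h \<times> 'h) set" where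
  "form_operator H V a = {(u, f). u \<in> V \<and> f \<in> H \<and> (\<forall>v\<in>V. a u v = inner f v)}"

definition adjoint_op ::
    "'h::real_inner set \<Rightarrow> ('h \<times> 'h) set \<Rightarrow> ('h \<times> 'h) set" where
  "adjoint_op H T = {(v, z). v \<in> H \<and> z \<in> H \<and> (\<forall>(u, f)\<in>T. inner f v = inner u z)}"

definition projection_valued_measure ::
    "'h::real_inner set \<Rightarrow> (real set \<Rightarrow> 'h \<Rightarrow> 'h) \<Rightarrow> bool" where
  "projection_valued_measure H E \<longleftrightarrow>
     (\<forall>S\<in>sets borel. \<forall>u\<in>H. E S u \<in> H) \<and>
     (\<forall>S\<in>sets borel. \<forall>u\<in>H. \<forall>v\<in>H. \<forall>c. E S (u + c *\<^sub>R v) = E S u + c *\<^sub>R E S v) \<and>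
     (\<forall>S\<in>sets borel. \<forall>u\<in>H. \<forall>v\<in>H. inner (E S u) v = inner u (E S v)) \<and>
     (\<forall>S\<in>sets borel. \<forall>T\<in>sets borel. \<forall>u\<in>H. E (S \<inter> T) u = E S (E T u)) \<and>
     (\<forall>u\<in>H. E UNIV u = u) \<and>
     (\<forall>S :: nat \<Rightarrow> real set. range S \<subseteq> sets borel \<longrightarrow> disjoint_family S \<longrightarrow>
        (\<forall>u\<in>H. (\<lambda>n. E (S n) u) sums E (\<Union>n. S n) u))"

definition scalar_measure :: "(real set \<Rightarrow> 'h::real_inner \<Rightarrow> 'h) \<Rightarrow> 'h \<Rightarrow> real measure" where
  "scalar_measure E u = measure_of UNIV (sets borel) (\<lambda>S. ennreal (inner (E S u) u))"

definition spectral_domain ::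
    "'h::real_inner set \<Rightarrow> (real set \<Rightarrow> 'h \<Rightarrow> 'h) \<Rightarrow> (real \<Rightarrow> real) \<Rightarrow> 'h set" where
  "spectral_domain H E f = {u \<in> H. integrable (scalar_measure E u) (\<lambda>x. (f x)\<^sup>2)}"

text \<open>The operator \<open>\<integral> f dE\<close>: its values are determined by
  \<open>\<langle>(\<integral> f dE) u, \<phi>\<rangle> = \<integral> f d\<langle>E u, \<phi>\<rangle>\<close> for \<open>\<phi>\<close> in the (dense) domain, where the signed measure
  \<open>\<langle>E u, \<phi>\<rangle>\<close> is written by polarization as a difference of positive measures.\<close>
definition spectral_integral ::
    "'h::real_inner set \<Rightarrow> (real set \<Rightarrow> 'h \<Rightarrow> 'h) \<Rightarrow> (real \<Rightarrow> real) \<Rightarrow> ('h \<times> 'h) set" where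
  "spectral_integral H E f = {(u, v). u \<in> spectral_domain H E f \<and> v \<in> H \<and>
     (\<forall>\<phi>\<in>spectral_domain H E f. inner v \<phi> =
        ((LINT x|scalar_measure E (u + \<phi>). f x) - (LINT x|scalar_measure E (u - \<phi>). f x)) / 4)}"

definition is_spectral_measure ::
    "'h::real_inner set \<Rightarrow> ('h \<times> 'h) set \<Rightarrow> (real set \<Rightarrow> 'h \<Rightarrow> 'h) \<Rightarrow> bool" where
  "is_spectral_measure H A E \<longleftrightarrow>
     projection_valued_measure H E \<and> A = spectral_integral H E (\<lambda>x. x)"

text \<open>\<open>f(A)\<close> for self-adjoint \<open>A\<close>, whose spectral measure exists and is unique (on \<open>H\<close>)
  by the spectral theorem.\<close>
definition functional_calculus ::
    "'h::real_inner set \<Rightarrow> ('h \<times> 'h) set \<Rightarrow> (real \<Rightarrow> real) \<Rightarrow> ('h \<times> 'h) set" where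
  "functional_calculus H A f =
     {(u, v). \<exists>E. is_spectral_measure H A E \<and> (u, v) \<in> spectral_integral H E f}"

text \<open>Used for nonnegative self-adjoint \<open>A\<close>, and with \<open>p < 0\<close> only when \<open>A\<close> is strictly
  positive.\<close>
definition op_power ::
    "'h::real_inner set \<Rightarrow> ('h \<times> 'h) set \<Rightarrow> real \<Rightarrow> ('h \<times> 'h) set" where
  "op_power H A p = functional_calculus H A (\<lambda>x. x powr p)"

definition op_semigroup ::
    "'h::real_inner set \<Rightarrow> ('h \<times> 'h) set \<Rightarrow> real \<Rightarrow> ('h \<times> 'h) set" where
  "op_semigroup H A t = functional_calculus H A (\<lambda>x. exp (- t * x))"

definition orthonormal_basis :: "'h::real_inner set \<Rightarrow> (nat \<Rightarrow> 'h) \<Rightarrow> bool" where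
  "orthonormal_basis H e \<longleftrightarrow>
     (\<forall>i j. inner (e i) (e j) = (if i = j then 1 else 0)) \<and> closure (span (range e)) = H"


section \<open>The operators of the problem\<close>

definition A_op :: "real \<Rightarrow> 'a::euclidean_space set \<Rightarrow> ('a L2 \<times> 'a L2) set" where
  "A_op s \<Omega> = form_operator (L2_on \<Omega>) (sobolev0 s \<Omega>) (frac_form s \<Omega>)"

text \<open>\<open>B = e\<^sup>-\<^sup>t\<^sup>A A\<^sup>-\<^sup>1\<^sup>/\<^sup>2\<close>\<close>
definition B_op :: "real \<Rightarrow> real \<Rightarrow> 'a::euclidean_space set \<Rightarrow> ('a L2 \<times> 'a L2) set" where
  "B_op s t \<Omega> =
     op_power (L2_on \<Omega>) (A_op s \<Omega>) (- 1 / 2) O op_semigroup (L2_on \<Omega>) (A_op s \<Omega>) t"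

definition BstarB :: "real \<Rightarrow> real \<Rightarrow> 'a::euclidean_space set \<Rightarrow> ('a L2 \<times> 'a L2) set" where
  "BstarB s t \<Omega> = B_op s t \<Omega> O adjoint_op (L2_on \<Omega>) (B_op s t \<Omega>)"

text \<open>\<open>A\<^sup>1\<^sup>/\<^sup>2 u = (B\<^sup>*B)\<^sup>\<beta> w\<close>, including \<open>u \<in> D(A\<^sup>1\<^sup>/\<^sup>2)\<close> and \<open>w \<in> D((B\<^sup>*B)\<^sup>\<beta>)\<close>.\<close>
definition source_condition ::
    "real \<Rightarrow> real \<Rightarrow> 'a::euclidean_space set \<Rightarrow> real \<Rightarrow> 'a L2 \<Rightarrow> 'a L2 \<Rightarrow> bool" where
  "source_condition s t \<Omega> \<beta> u w \<longleftrightarrow>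
     (\<exists>z. (u, z) \<in> op_power (L2_on \<Omega>) (A_op s \<Omega>) (1 / 2) \<and>
          (w, z) \<in> op_power (L2_on \<Omega>) (BstarB s t \<Omega>) \<beta>)"

end

theory Submission
  imports Defs
begin

text \<open>
  Everything is diagonal in the eigenbasis. The Gagliardo quotient maps \<open>H\<^sup>s\<close> into \<open>L\<^sup>2\<close> of the
  product space and is a closed operator, so the form is closed and \<open>A\<^sub>s\<close> is exactly the diagonal
  operator with entries \<open>\<lambda>\<^sub>j\<close> on its maximal domain. Every spectral measure \<open>E\<close> of a diagonal
  operator satisfies \<open>E S e\<^sub>j = 1\<^sub>S(\<lambda>\<^sub>j) e\<^sub>j\<close>, whence \<open>f(A)\<close> is diagonal with entries
  \<open>f(\<lambda>\<^sub>j)\<close>. Thus \<open>(B\<^sup>*B)\<^sup>\<beta>\<close> has entries \<open>\<lambda>\<^sub>j\<^sup>-\<^sup>\<beta> e\<^sup>-\<^sup>2\<^sup>\<beta>\<^sup>t\<^sup>\<lambda>\<^sup>j\<close>, and the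
  source condition is read off coefficient by coefficient.
\<close>

section \<open>Diagonal operators on a Hilbert space\<close>

text \<open>The eigenvectors are given, but the domain of \<open>A_op\<close> is not, and
  \<open>is_spectral_measure\<close> demands equality of graphs. Hence every u in
  \<open>L2_on \<Omega>\<close> whose sequence \<open>lam j * (u \<bullet> e j)\<close> is square
  summable must be shown to lie in \<open>sobolev0\<close>. This is where closedness of the
  Gagliardo quotient enters, and with it completeness of \<open>L2\<close>, also over the product
  space. Composition of graphs is equally sensitive to domains; the first factor of each composite
  has entries bounded by 1 because \<open>lam j\<close> is at least 1. For the same reason the
  entries of the power of \<open>BstarB\<close> are at most 1. So in the converse implication the
  common value z of both sides is constructed from w, and membership of u in the domain of the
  square root comes out with it.\<close>

lemma abs_le_one_plus_square: "\<bar>y\<bar> \<le> 1 + y\<^sup>2" for y :: real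
  using sum_squares_bound[of 1 "\<bar>y\<bar>"] by simp

text \<open>By Pythagoras the squared norm of a block of the series is the block of squared norms,
  so the Cauchy criterion for the squares, taken with \<open>r\<^sup>2\<close>, is the one for the
  vectors.\<close>

lemma summable_orthogonal:
  fixes x :: "nat \<Rightarrow> 'h::{real_inner,banach}"
  assumes orth: "\<And>i j. i \<noteq> j \<Longrightarrow> x i \<bullet> x j = 0"
    and sq: "summable (\<lambda>i. (norm (x i))\<^sup>2)"
  shows "summable x"
proof -
  have pyth: "(norm (sum x {m..<n}))\<^sup>2 = (\<Sum>i=m..<n. (norm (x i))\<^sup>2)" for m n
    by (rule norm_sum_Pythagorean) (auto simp: pairwise_def orthogonal_def orth)
  show ?thesis
    unfolding summable_Cauchy
  proof (intro allI impI)
    fix r :: real assume "0 < r"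
    then obtain N where N: "\<And>m n. N \<le> m \<Longrightarrow> norm (\<Sum>i=m..<n. (norm (x i))\<^sup>2) < r\<^sup>2"
      using sq unfolding summable_Cauchy by (meson zero_less_power)
    have "norm (sum x {m..<n}) < r" if "N \<le> m" for m n
      using N[OF that, of n] \<open>0 < r\<close> unfolding pyth[symmetric]
      by (auto intro: power2_less_imp_less)
    then show "\<exists>N. \<forall>m\<ge>N. \<forall>n. norm (sum x {m..<n}) < r" by blast
  qed
qed

lemma subspace_closure_normed:
  fixes S :: "'h::real_normed_vector set"
  assumes "subspace S"
  shows "subspace (closure S)"
  unfolding subspace_def
proof (intro conjI ballI allI)
  show "0 \<in> closure S"
    using assms closure_subset subspace_0 by blast
next
  fix x y assume "x \<in> closure S" "y \<in> closure S"
  then obtain f g where fg: "\<forall>n. f n \<in> S" "f \<longlonglongrightarrow> x" "\<forall>n. g n \<in> S" "g \<longlonglongrightarrow> y"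
    unfolding closure_sequential by auto
  then show "x + y \<in> closure S"
    unfolding closure_sequential
    by (intro exI[where x = "\<lambda>n. f n + g n"] conjI tendsto_add)
      (auto intro: subspace_add[OF assms])
next
  fix c x assume "x \<in> closure S"
  then obtain f where "\<forall>n. f n \<in> S" "f \<longlonglongrightarrow> x"
    unfolding closure_sequential by auto
  then show "c *\<^sub>R x \<in> closure S"
    unfolding closure_sequential
    by (intro exI[where x = "\<lambda>n. c *\<^sub>R f n"] conjI tendsto_scaleR tendsto_const)
      (auto intro: subspace_scale[OF assms])
qed

text \<open>The Hilbert space is a closed subspace \<open>H\<close> of the ambient type because
  \<open>L2_on \<Omega>\<close> sits inside the functions on the whole space. Vectors outside
  \<open>H\<close> also have coefficients, but are not determined by them.\<close>

locale hilbert_basis =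
  fixes H :: "'h::{real_inner,banach} set" and e :: "nat \<Rightarrow> 'h"
  assumes basis: "orthonormal_basis H e"
begin

lemma inner_basis: "e i \<bullet> e j = (if i = j then 1 else 0)"
  using basis by (simp add: orthonormal_basis_def)

lemma H_eq: "H = closure (span (range e))"
  using basis by (simp add: orthonormal_basis_def)

lemma subspace_H: "subspace H"
  unfolding H_eq by (intro subspace_closure_normed subspace_span)

lemma closed_H: "closed H"
  unfolding H_eq by simp

lemma basis_in_H [simp]: "e j \<in> H"
  unfolding H_eq by (meson closure_subset rangeI span_base subsetD)

lemma zero_in_H [simp]: "0 \<in> H"
  and add_in_H: "u \<in> H \<Longrightarrow> v \<in> H \<Longrightarrow> u + v \<in> H"
  and diff_in_H: "u \<in> H \<Longrightarrow> v \<in> H \<Longrightarrow> u - v \<in> H"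
  and scale_in_H: "u \<in> H \<Longrightarrow> c *\<^sub>R u \<in> H"
  using subspace_H by (auto simp: subspace_def intro: subspace_diff)

lemma sums_in_H: "(\<And>j. x j \<in> H) \<Longrightarrow> x sums v \<Longrightarrow> v \<in> H"
  unfolding sums_def
  by (rule closed_sequentially[OF closed_H]) (auto intro: subspace_sum[OF subspace_H])

lemma coef_of_sums:
  assumes "(\<lambda>j. c j *\<^sub>R e j) sums v"
  shows "v \<bullet> e i = c i"
proof -
  have "(\<lambda>j. (c j *\<^sub>R e j) \<bullet> e i) sums (v \<bullet> e i)"
    by (rule bounded_linear.sums[OF bounded_linear_inner_left assms])
  moreover have "(\<lambda>j. (c j *\<^sub>R e j) \<bullet> e i) = (\<lambda>j. if j = i then c j else 0)"
    by (auto simp: inner_basis)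
  ultimately show ?thesis
    using sums_single[of i c] sums_unique2 by metis
qed

text \<open>The difference is orthogonal to the span of the basis, hence to its closure, which
  contains the difference itself.\<close>

lemma eq_if_coef_eq:
  assumes "u \<in> H" "v \<in> H" "\<And>j. u \<bullet> e j = v \<bullet> e j"
  shows "u = v"
proof -
  have "closure (span (range e)) \<subseteq> {x. (u - v) \<bullet> x = 0}"
  proof (rule closure_minimal)
    show "closed {x. (u - v) \<bullet> x = 0}"
      by (rule closed_hyperplane)
    show "span (range e) \<subseteq> {x. (u - v) \<bullet> x = 0}"
      by (rule span_minimal)
        (auto simp: assms(3) inner_diff_left subspace_def inner_add_right)
  qed
  then have "(u - v) \<bullet> (u - v) = 0"
    using diff_in_H[OF assms(1,2)] H_eq by auto
  then show ?thesis by simp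
qed

lemma summable_basis:
  "summable (\<lambda>j. (c j)\<^sup>2) \<Longrightarrow> summable (\<lambda>j. c j *\<^sub>R e j)"
  by (rule summable_orthogonal)
    (auto simp: inner_basis norm_eq_sqrt_inner power2_eq_square)

lemma ex_coef:
  assumes "summable (\<lambda>j. (c j)\<^sup>2)"
  obtains v where "v \<in> H" "\<And>j. v \<bullet> e j = c j"
proof -
  have "(\<lambda>j. c j *\<^sub>R e j) sums (\<Sum>j. c j *\<^sub>R e j)"
    using summable_basis[OF assms] by (rule summable_sums)
  from coef_of_sums[OF this] sums_in_H[OF _ this] show ?thesis
    by (intro that) (auto simp: scale_in_H)
qed

text \<open>Expand the nonnegative square of u - p, with p the projection onto the first n basis
  vectors.\<close>

lemma bessel: "(\<Sum>j<n. (u \<bullet> e j)\<^sup>2) \<le> (norm u)\<^sup>2"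
proof -
  define p where "p = (\<Sum>j<n. (u \<bullet> e j) *\<^sub>R e j)"
  have "u \<bullet> p = (\<Sum>j<n. (u \<bullet> e j)\<^sup>2)"
    by (simp add: p_def inner_sum_right power2_eq_square)
  moreover have "p \<bullet> p = (\<Sum>j<n. (u \<bullet> e j)\<^sup>2)"
    by (simp add: p_def inner_sum_right inner_sum_left inner_basis power2_eq_square
        if_distrib[of "\<lambda>x. _ * x"] cong: if_cong)
  moreover have "0 \<le> (u - p) \<bullet> (u - p)" by (rule inner_ge_zero)
  ultimately show ?thesis
    by (simp add: inner_diff_left inner_diff_right inner_commute flip: dot_square_norm)
qed

lemma summable_coef_sq: "summable (\<lambda>j. (u \<bullet> e j)\<^sup>2)"
  by (rule summableI_nonneg_bounded[OF _ bessel]) simp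

lemma expansion:
  assumes "u \<in> H"
  shows "(\<lambda>j. (u \<bullet> e j) *\<^sub>R e j) sums u"
proof -
  have s: "(\<lambda>j. (u \<bullet> e j) *\<^sub>R e j) sums (\<Sum>j. (u \<bullet> e j) *\<^sub>R e j)"
    by (rule summable_sums[OF summable_basis[OF summable_coef_sq]])
  moreover have "(\<Sum>j. (u \<bullet> e j) *\<^sub>R e j) = u"
  proof (rule eq_if_coef_eq)
    show "(\<Sum>j. (u \<bullet> e j) *\<^sub>R e j) \<in> H"
      using s by (rule sums_in_H[rotated]) (simp add: scale_in_H)
  qed (use assms coef_of_sums[OF s] in auto)
  ultimately show ?thesis by simp
qed

lemma parseval:
  assumes "u \<in> H"
  shows "(\<lambda>j. (u \<bullet> e j) * (v \<bullet> e j)) sums (u \<bullet> v)"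
  using bounded_linear.sums[OF bounded_linear_inner_left expansion[OF assms], of v]
  by (simp add: inner_commute)

text \<open>A bounded multiplier preserves square summability. This supplies intermediate vectors of
  compositions, spectral projections and the vector z of the source condition.\<close>

lemma ex_bounded_multiple:
  assumes "\<And>j. \<bar>c j\<bar> \<le> K"
  obtains v where "v \<in> H" "\<And>j. v \<bullet> e j = c j * (u \<bullet> e j)"
proof (rule ex_coef)
  show "summable (\<lambda>j. (c j * (u \<bullet> e j))\<^sup>2)"
  proof (rule summable_comparison_test')
    show "summable (\<lambda>j. K\<^sup>2 * (u \<bullet> e j)\<^sup>2)"
      by (intro summable_mult summable_coef_sq)
    show "norm ((c n * (u \<bullet> e n))\<^sup>2) \<le> K\<^sup>2 * (u \<bullet> e n)\<^sup>2" if "0 \<le> n" for n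
      using power_mono[OF assms[of n], of 2]
      by (simp add: power_mult_distrib mult_right_mono)
  qed
qed blast

text \<open>The domain is maximal without being mentioned: a suitable v in \<open>H\<close> exists
  exactly when the multiplied coefficients are square summable.\<close>

definition diag_op :: "(nat \<Rightarrow> real) \<Rightarrow> ('h \<times> 'h) set" where
  "diag_op c = {(u, v). u \<in> H \<and> v \<in> H \<and> (\<forall>j. v \<bullet> e j = c j * (u \<bullet> e j))}"

lemma diag_opI: "u \<in> H \<Longrightarrow> v \<in> H \<Longrightarrow> (\<And>j. v \<bullet> e j = c j * (u \<bullet> e j)) \<Longrightarrow> (u, v) \<in> diag_op c"
  by (simp add: diag_op_def)

lemma basis_in_diag_op: "(e j, c j *\<^sub>R e j) \<in> diag_op c"
  by (rule diag_opI) (auto simp: inner_basis scale_in_H)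

text \<open>The bound concerns the factor applied first, which is thereby defined on all of
  \<open>H\<close>. For unbounded \<open>c\<close> the composition can have a smaller domain than
  the diagonal operator of the products.\<close>

lemma diag_op_comp:
  assumes "\<And>j. \<bar>c j\<bar> \<le> K"
  shows "diag_op c O diag_op d = diag_op (\<lambda>j. c j * d j)"
proof (intro equalityI subrelI)
  fix u v assume "(u, v) \<in> diag_op c O diag_op d"
  then show "(u, v) \<in> diag_op (\<lambda>j. c j * d j)" by (auto simp: diag_op_def)
next
  fix u v assume *: "(u, v) \<in> diag_op (\<lambda>j. c j * d j)"
  obtain m where "m \<in> H" "\<And>j. m \<bullet> e j = c j * (u \<bullet> e j)"
    by (rule ex_bounded_multiple[where c = c and u = u, OF assms]) blast
  with * show "(u, v) \<in> diag_op c O diag_op d"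
    by (intro relcompI[where b = m]) (auto simp: diag_op_def)
qed

text \<open>Testing with basis vectors determines the coefficients of an adjoint pair; conversely
  Parseval moves the real entries from one factor to the other.\<close>

lemma adjoint_diag_op: "adjoint_op H (diag_op c) = diag_op c"
proof (intro equalityI subrelI)
  fix v z assume "(v, z) \<in> adjoint_op H (diag_op c)"
  then have vz: "v \<in> H" "z \<in> H" and "\<And>u f. (u, f) \<in> diag_op c \<Longrightarrow> f \<bullet> v = u \<bullet> z"
    by (auto simp: adjoint_op_def)
  from this(3)[OF basis_in_diag_op] show "(v, z) \<in> diag_op c"
    by (intro diag_opI vz) (metis inner_commute inner_scaleR_left)
next
  fix v z assume vz: "(v, z) \<in> diag_op c"
  have "f \<bullet> v = u \<bullet> z" if "(u, f) \<in> diag_op c" for u f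
  proof -
    have "(\<lambda>j. (f \<bullet> e j) * (v \<bullet> e j)) = (\<lambda>j. (u \<bullet> e j) * (z \<bullet> e j))"
      using that vz by (auto simp: diag_op_def)
    moreover have "u \<in> H" "f \<in> H" using that by (auto simp: diag_op_def)
    ultimately show ?thesis using parseval sums_unique2 by metis
  qed
  with vz show "(v, z) \<in> adjoint_op H (diag_op c)"
    by (auto simp: adjoint_op_def diag_op_def)
qed

end


section \<open>Eigenvectors and spectral measures\<close>

text \<open>\<open>measure_of\<close> depends only on the values on the sigma-algebra, so agreement
  with an existing measure replaces a proof of countable additivity.\<close>

lemma scalar_measure_eqI:
  assumes sets: "sets M = sets borel"
    and emeasure: "\<And>S. S \<in> sets borel \<Longrightarrow> emeasure M S = ennreal (E S u \<bullet> u)"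
  shows "scalar_measure E u = M"
proof -
  have space: "space M = UNIV"
    using sets_eq_imp_space_eq[OF sets] by simp
  have sig: "sigma_sets UNIV (sets borel) = (sets borel :: real set set)"
    using sets.sigma_sets_eq[of "borel :: real measure"] by simp
  have "scalar_measure E u = measure_of (space M) (sets M) (emeasure M)"
    unfolding scalar_measure_def sets space
    by (rule measure_of_eq) (auto simp: sig emeasure)
  then show ?thesis by (simp add: measure_of_of_measure)
qed

locale pvm =
  fixes H :: "'h::real_inner set" and E :: "real set \<Rightarrow> 'h \<Rightarrow> 'h"
  assumes pvm: "projection_valued_measure H E"
    and subspace: "subspace H"
begin

lemma closed: "S \<in> sets borel \<Longrightarrow> u \<in> H \<Longrightarrow> E S u \<in> H"
  and linear: "S \<in> sets borel \<Longrightarrow> u \<in> H \<Longrightarrow> v \<in> H \<Longrightarrow> E S (u + c *\<^sub>R v) = E S u + c *\<^sub>R E S v"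
  and symmetric: "S \<in> sets borel \<Longrightarrow> u \<in> H \<Longrightarrow> v \<in> H \<Longrightarrow> E S u \<bullet> v = u \<bullet> E S v"
  and Int: "S \<in> sets borel \<Longrightarrow> T \<in> sets borel \<Longrightarrow> u \<in> H \<Longrightarrow> E (S \<inter> T) u = E S (E T u)"
  and UNIV: "u \<in> H \<Longrightarrow> E UNIV u = u"
  and sums_UN: "range A \<subseteq> sets borel \<Longrightarrow> disjoint_family A \<Longrightarrow> u \<in> H \<Longrightarrow>
    (\<lambda>n. E (A n) u) sums E (\<Union>n. A n) u"
  using pvm unfolding projection_valued_measure_def by auto

lemma zero: "S \<in> sets borel \<Longrightarrow> E S 0 = 0"
  using linear[of S 0 0 1] subspace_0[OF subspace] by simp

lemma lincomb:
  assumes "S \<in> sets borel" "u \<in> H" "v \<in> H"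
  shows "E S (a *\<^sub>R u + c *\<^sub>R v) = a *\<^sub>R E S u + c *\<^sub>R E S v"
  using linear[of S "a *\<^sub>R u" v c] linear[of S 0 u a] assms zero subspace_0[OF subspace]
    subspace_scale[OF subspace] by simp

text \<open>The constant sequence of empty sets is disjoint, and a constant series converges only if
  its term is zero.\<close>

lemma empty: "u \<in> H \<Longrightarrow> E {} u = 0"
  using sums_UN[of "\<lambda>_. {}" u]
  by (auto simp: disjoint_family_on_def summable_const_iff dest: sums_summable)

text \<open>Symmetry and multiplicativity of the projections. All cross terms below become values of
  one scalar measure; the case S = T gives positivity.\<close>

lemma inner_Int:
  assumes "S \<in> sets borel" "T \<in> sets borel" "u \<in> H"
  shows "E S u \<bullet> E T u = E (S \<inter> T) u \<bullet> u"
  using symmetric[OF assms(2) closed[OF assms(1,3)] assms(3)] Int[OF assms(2,1,3)]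
  by (simp add: Int_commute)

lemma nonneg: "S \<in> sets borel \<Longrightarrow> u \<in> H \<Longrightarrow> 0 \<le> E S u \<bullet> u"
  using inner_Int[of S S u] inner_ge_zero[of "E S u"] by simp

lemma sets_scalar_measure [simp, measurable_cong]: "sets (scalar_measure E u) = sets borel"
  using sets.sigma_sets_eq[of "borel :: real measure"] by (simp add: scalar_measure_def)

lemma space_scalar_measure [simp]: "space (scalar_measure E u) = UNIV"
  by (simp add: scalar_measure_def)

lemma emeasure_scalar_measure:
  assumes "u \<in> H" "S \<in> sets borel"
  shows "emeasure (scalar_measure E u) S = ennreal (E S u \<bullet> u)"
  unfolding scalar_measure_def
proof (rule emeasure_measure_of_sigma)
  show "sigma_algebra UNIV (sets borel :: real set set)"
    using sets.sigma_algebra_axioms[of "borel :: real measure"] by simp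
  show "positive (sets borel) (\<lambda>S. ennreal (E S u \<bullet> u))"
    by (simp add: positive_def empty assms)
  show "countably_additive (sets borel) (\<lambda>S. ennreal (E S u \<bullet> u))"
  proof (rule countably_additiveI)
    fix A :: "nat \<Rightarrow> real set"
    assume A: "range A \<subseteq> sets borel" "disjoint_family A"
    have "(\<lambda>n. E (A n) u \<bullet> u) sums (E (\<Union>n. A n) u \<bullet> u)"
      by (rule bounded_linear.sums[OF bounded_linear_inner_left sums_UN[OF A assms(1)]])
    then show "(\<Sum>i. ennreal (E (A i) u \<bullet> u)) = ennreal (E (\<Union>i. A i) u \<bullet> u)"
      using A assms by (intro suminf_ennreal_eq nonneg) auto
  qed
qed (fact assms)

lemma finite_scalar_measure: "u \<in> H \<Longrightarrow> finite_measure (scalar_measure E u)"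
  by (rule finite_measureI) (simp add: emeasure_scalar_measure)

lemma integrable_indicator_scalar_measure:
  assumes "u \<in> H" "S \<in> sets borel"
  shows "integrable (scalar_measure E u) (indicator S :: real \<Rightarrow> real)"
  using assms by (intro integrable_real_indicator) (simp_all add: emeasure_scalar_measure)

lemma measure_scalar_measure:
  assumes "u \<in> H" "S \<in> sets borel"
  shows "measure (scalar_measure E u) S = E S u \<bullet> u"
  using emeasure_scalar_measure[OF assms] nonneg[OF assms(2,1)] by (simp add: measure_def)

text \<open>The vector has weight a + c on the spectral part in S and weight a off it, so the
  density is \<open>(a + c)\<^sup>2\<close> on S and \<open>a\<^sup>2\<close> elsewhere. It
  evaluates both measures of the polarization formula when the test vector is
  \<open>E S u\<close>.\<close>

lemma scalar_measure_lincomb: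
  assumes u: "u \<in> H" and S [measurable]: "S \<in> sets borel"
  shows "scalar_measure E (a *\<^sub>R u + c *\<^sub>R E S u) =
    density (scalar_measure E u) (\<lambda>x. ennreal (a\<^sup>2 + (2 * a * c + c\<^sup>2) * indicator S x))"
    (is "_ = density ?M (\<lambda>x. ennreal (?g x))")
proof (rule scalar_measure_eqI)
  interpret finite_measure ?M using u by (rule finite_scalar_measure)
  fix T :: "real set" assume T [measurable]: "T \<in> sets borel"
  have nn: "0 \<le> ?g x" for x
    using zero_le_power2[of "a + c"] by (auto simp: indicator_def power2_sum)
  have int: "integrable ?M (\<lambda>x. a\<^sup>2 * indicator T x + (2 * a * c + c\<^sup>2) * indicator (S \<inter> T) x)"
    by (intro Bochner_Integration.integrable_add integrable_mult_right
        integrable_indicator_scalar_measure u) auto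
  have eq: "?g x * indicator T x =
      a\<^sup>2 * indicator T x + (2 * a * c + c\<^sup>2) * indicator (S \<inter> T) x" for x
    by (auto simp: indicator_def)
  have "emeasure (density ?M (\<lambda>x. ennreal (?g x))) T = (\<integral>\<^sup>+x. ennreal (?g x * indicator T x) \<partial>?M)"
    by (subst emeasure_density)
      (auto intro!: nn_integral_cong simp: ennreal_mult' nn ennreal_indicator indicator_def)
  also have "\<dots> = ennreal (\<integral>x. ?g x * indicator T x \<partial>?M)"
    by (rule nn_integral_eq_integral) (use int nn in \<open>auto simp: eq[symmetric]\<close>)
  also have "(\<integral>x. ?g x * indicator T x \<partial>?M) =
      a\<^sup>2 * (E T u \<bullet> u) + (2 * a * c + c\<^sup>2) * (E (S \<inter> T) u \<bullet> u)"
    unfolding eq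
    by (subst Bochner_Integration.integral_add) (simp_all add: measure_scalar_measure
        integrable_indicator_scalar_measure u)
  also have "\<dots> = E T (a *\<^sub>R u + c *\<^sub>R E S u) \<bullet> (a *\<^sub>R u + c *\<^sub>R E S u)"
  proof -
    have "E T (a *\<^sub>R u + c *\<^sub>R E S u) = a *\<^sub>R E T u + c *\<^sub>R E (S \<inter> T) u"
      using lincomb[OF T u closed[OF S u]] Int[OF T S u] by (simp add: Int_commute)
    then show ?thesis
      using inner_Int[OF T S u] inner_Int[of "S \<inter> T" S u] u
      by (simp add: inner_add_left inner_add_right algebra_simps power2_eq_square
          Int_ac)
  qed
  finally show "emeasure (density ?M (\<lambda>x. ennreal (?g x))) T =
    ennreal (E T (a *\<^sub>R u + c *\<^sub>R E S u) \<bullet> (a *\<^sub>R u + c *\<^sub>R E S u))" .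
qed simp

text \<open>Testing the defining identity of \<open>(\<integral> x dE) u = l u\<close> against \<open>\<phi> = E S u\<close> gives
  \<open>\<integral>\<^sub>S (x - l) d\<langle>E u, u\<rangle> = 0\<close> for every Borel set \<open>S\<close>, so \<open>\<langle>E u, u\<rangle>\<close> is concentrated at \<open>l\<close>.\<close>
lemma eigenvector:
  assumes eig: "(u, l *\<^sub>R u) \<in> spectral_integral H E (\<lambda>x. x)" and S: "S \<in> sets borel"
  shows "E S u = indicator S l *\<^sub>R u"
proof -
  let ?M = "scalar_measure E u"
  have u: "u \<in> H" and x2: "integrable ?M (\<lambda>x. x\<^sup>2)"
    using eig by (auto simp: spectral_integral_def spectral_domain_def)
  interpret finite_measure ?M using u by (rule finite_scalar_measure)
  have x1: "integrable ?M (\<lambda>x. x)"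
  proof (rule Bochner_Integration.integrable_bound)
    show "integrable ?M (\<lambda>x. 1 + x\<^sup>2)" using x2 by auto
    show "AE x in ?M. norm x \<le> norm (1 + x\<^sup>2)"
      by (simp add: abs_le_one_plus_square)
  qed simp
  have zero_integral: "(\<integral>x. indicator T x * (x - l) \<partial>?M) = 0"
    if T [measurable]: "T \<in> sets borel" for T
  proof -
    have xT: "integrable ?M (\<lambda>x. indicator T x * x)"
      by (rule Bochner_Integration.integrable_bound[OF x1]) (auto simp: indicator_def)
    have dens: "(LINT x|scalar_measure E (a *\<^sub>R u + c *\<^sub>R E T u). x) =
        (\<integral>x. (a\<^sup>2 + (2 * a * c + c\<^sup>2) * indicator T x) * x \<partial>?M)" for a c
      unfolding scalar_measure_lincomb[OF u T]
      using zero_le_power2[of "a + c"]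
      by (subst integral_density) (auto simp: indicator_def power2_sum)
    \<comment> \<open>The case a = 0, c = 1 of the density formula: restricting the measure to T
      keeps the square integrable, so \<open>E T u\<close> is an admissible test vector.\<close>
    have dom: "E T u \<in> spectral_domain H E (\<lambda>x. x)"
    proof -
      have "integrable ?M (\<lambda>x. indicator T x * x\<^sup>2)"
        by (rule Bochner_Integration.integrable_bound[OF x2]) (auto simp: indicator_def)
      then show ?thesis
        using scalar_measure_lincomb[OF u T, of 0 1] closed[OF T u]
        by (simp add: spectral_domain_def integrable_density)
    qed
    have "l * measure ?M T = (l *\<^sub>R u) \<bullet> E T u"
      using symmetric[OF T u u] by (simp add: measure_scalar_measure u)
    also have "\<dots> = ((LINT x|scalar_measure E (u + E T u). x) -
        (LINT x|scalar_measure E (u - E T u). x)) / 4"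
      using eig dom by (auto simp: spectral_integral_def)
    \<comment> \<open>With a = 1 and c = 1 or -1 the densities are 4 and 0 on T and both 1 off T;
      their difference cancels the factor 1/4.\<close>
    also have "\<dots> = ((\<integral>x. (1 + 3 * indicator T x) * x \<partial>?M) - (\<integral>x. (1 - indicator T x) * x \<partial>?M)) / 4"
      using dens[of 1 1] dens[of 1 "-1"] by simp
    also have "\<dots> = (\<integral>x. indicator T x * x \<partial>?M)"
      using x1 xT by (simp add: distrib_right left_diff_distrib mult.assoc)
    finally show ?thesis
      using xT integrable_indicator_scalar_measure[OF u T]
      by (simp add: right_diff_distrib measure_scalar_measure mult.commute[of _ l])
  qed
  have integrable: "integrable ?M (\<lambda>x. indicator T x * (x - l))"
    if [measurable]: "T \<in> sets borel" for T
  proof (rule Bochner_Integration.integrable_bound)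
    show "integrable ?M (\<lambda>x. x - l)" using x1 by simp
    show "AE x in ?M. norm (indicator T x * (x - l)) \<le> norm (x - l)"
      by (rule AE_I2) (simp add: indicator_def)
  qed measurable
  \<comment> \<open>On each open half-line beside l the integrand has constant sign, so its
    vanishing integral makes it vanish almost everywhere.\<close>
  have "(AE x in ?M. indicator {l<..} x * (x - l) = 0) \<longleftrightarrow> (\<integral>x. indicator {l<..} x * (x - l) \<partial>?M) = 0"
    by (rule integral_nonneg_eq_0_iff_AE[symmetric, OF integrable])
      (simp, rule AE_I2, simp add: indicator_def)
  moreover have "(AE x in ?M. indicator {..<l} x * (l - x) = 0) \<longleftrightarrow> (\<integral>x. indicator {..<l} x * (l - x) \<partial>?M) = 0"
  proof (rule integral_nonneg_eq_0_iff_AE[symmetric])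
    show "integrable ?M (\<lambda>x. indicator {..<l} x * (l - x))"
      using integrable_minus[OF integrable[of "{..<l}"]] by (simp add: right_diff_distrib)
    show "AE x in ?M. 0 \<le> indicator {..<l} x * (l - x)"
      by (rule AE_I2) (simp add: indicator_def)
  qed
  moreover have "(\<integral>x. indicator {..<l} x * (l - x) \<partial>?M) = - (\<integral>x. indicator {..<l} x * (x - l) \<partial>?M)"
    unfolding integral_minus[symmetric] by (simp add: right_diff_distrib)
  ultimately have "AE x in ?M. indicator {l<..} x * (x - l) = 0" "AE x in ?M. indicator {..<l} x * (l - x) = 0"
    by (simp_all add: zero_integral)
  then have "AE x in ?M. x = l"
    by eventually_elim (auto simp: indicator_def split: if_splits)
  then have "(\<integral>x. indicator S x \<partial>?M) = (\<integral>x. (indicator S l :: real) \<partial>?M)"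
    using S by (intro integral_cong_AE) auto
  then have m: "E S u \<bullet> u = indicator S l * (u \<bullet> u)"
    using S by (simp add: measure_scalar_measure u UNIV)
  \<comment> \<open>Concentration at l gives only the quadratic form of \<open>E S\<close>. Since
    \<open>E S\<close> is a projection, that form also fixes the norm of \<open>E S u\<close>, and
    the difference has norm zero.\<close>
  have "(E S u - indicator S l *\<^sub>R u) \<bullet> (E S u - indicator S l *\<^sub>R u) = 0"
    using inner_Int[OF S S u] m inner_commute[of u "E S u"]
    by (simp add: inner_diff_left inner_diff_right indicator_def)
  then show ?thesis by simp
qed

end


section \<open>Functional calculus of diagonal operators\<close>

context hilbert_basis
begin

section \<open>Spectral integrals of any projection-valued measure diagonal in the basis\<close>

context
  fixes E :: "real set \<Rightarrow> 'h \<Rightarrow> 'h" and lam :: "nat \<Rightarrow> real"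
  assumes pvm: "projection_valued_measure H E"
    and E_basis: "\<And>S j. S \<in> sets borel \<Longrightarrow> E S (e j) = indicator S (lam j) *\<^sub>R e j"
begin

interpretation pvm H E
  using pvm subspace_H by unfold_locales

lemma E_coef:
  assumes "S \<in> sets borel" "u \<in> H"
  shows "E S u \<bullet> e j = indicator S (lam j) * (u \<bullet> e j)"
  using symmetric[OF assms basis_in_H] E_basis[OF assms(1)] by simp

text \<open>By Parseval the measure puts mass \<open>(u \<bullet> e j)\<^sup>2\<close> at
  \<open>lam j\<close>. As an image of a weighted counting measure it adds up repeated eigenvalues
  by itself and turns integrals into series.\<close>

lemma scalar_measure_eq:
  assumes u: "u \<in> H"
  shows "scalar_measure E u =
    distr (density (count_space UNIV) (\<lambda>j. ennreal ((u \<bullet> e j)\<^sup>2))) borel lam"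
    (is "_ = distr ?D borel lam")
proof (rule scalar_measure_eqI)
  fix S :: "real set" assume S: "S \<in> sets borel"
  have "(\<lambda>j. (E S u \<bullet> e j) * (u \<bullet> e j)) sums (E S u \<bullet> u)"
    by (rule parseval[OF closed[OF S u]])
  then have "(\<Sum>j. ennreal ((u \<bullet> e j)\<^sup>2 * indicator S (lam j))) = ennreal (E S u \<bullet> u)"
    by (intro suminf_ennreal_eq) (simp_all add: E_coef S u power2_eq_square mult_ac)
  moreover have "emeasure (distr ?D borel lam) S =
      (\<Sum>j. ennreal ((u \<bullet> e j)\<^sup>2 * indicator S (lam j)))"
    using S
    by (subst emeasure_distr)
      (auto simp: emeasure_density nn_integral_count_space_nat indicator_def
        intro!: suminf_cong)
  ultimately show "emeasure (distr ?D borel lam) S = ennreal (E S u \<bullet> u)" by simp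
qed simp

lemma integrable_scalar_measure_iff:
  assumes "u \<in> H" and [measurable]: "f \<in> borel_measurable borel"
  shows "integrable (scalar_measure E u) f \<longleftrightarrow> summable (\<lambda>j. (u \<bullet> e j)\<^sup>2 * \<bar>f (lam j)\<bar>)"
  by (simp add: scalar_measure_eq assms(1) integrable_distr_eq integrable_density
      integrable_count_space_nat_iff abs_mult)

lemma integral_scalar_measure_sums:
  fixes f :: "real \<Rightarrow> real"
  assumes "u \<in> H" and [measurable]: "f \<in> borel_measurable borel"
    and "summable (\<lambda>j. (u \<bullet> e j)\<^sup>2 * \<bar>f (lam j)\<bar>)"
  shows "(\<lambda>j. (u \<bullet> e j)\<^sup>2 * f (lam j)) sums (LINT x|scalar_measure E u. f x)"
proof -
  have "integrable (count_space UNIV) (\<lambda>j. (u \<bullet> e j)\<^sup>2 * f (lam j))"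
    using assms(3) by (simp add: integrable_count_space_nat_iff abs_mult)
  from sums_integral_count_space_nat[OF this] show ?thesis
    by (simp add: scalar_measure_eq assms(1) integral_distr integral_density)
qed

lemma spectral_domain_iff:
  assumes "f \<in> borel_measurable borel"
  shows "u \<in> spectral_domain H E f \<longleftrightarrow> u \<in> H \<and> summable (\<lambda>j. ((u \<bullet> e j) * f (lam j))\<^sup>2)"
  using assms integrable_scalar_measure_iff[of u "\<lambda>x. (f x)\<^sup>2"]
  by (auto simp: spectral_domain_def power_mult_distrib)

text \<open>The domain controls only the square of f. Integrability of f itself follows from |f| <=
  1 + f^2, together with (a + b)^2 <= 2 a^2 + 2 b^2.\<close>

lemma spectral_domain_sums:
  assumes f: "f \<in> borel_measurable borel"
    and u: "u \<in> spectral_domain H E f" and v: "v \<in> spectral_domain H E f"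
  shows "(\<lambda>j. ((u + v) \<bullet> e j)\<^sup>2 * f (lam j)) sums (LINT x|scalar_measure E (u + v). f x)"
proof (rule integral_scalar_measure_sums[OF _ f])
  show "u + v \<in> H" using u v by (simp add: spectral_domain_iff f add_in_H)
  let ?g = "\<lambda>j. 2 * (u \<bullet> e j)\<^sup>2 + 2 * (v \<bullet> e j)\<^sup>2 +
    2 * ((u \<bullet> e j) * f (lam j))\<^sup>2 + 2 * ((v \<bullet> e j) * f (lam j))\<^sup>2"
  have "summable ?g"
    using u v by (intro summable_add summable_mult summable_coef_sq) (auto simp: spectral_domain_iff f)
  moreover have "norm (((u + v) \<bullet> e j)\<^sup>2 * \<bar>f (lam j)\<bar>) \<le> ?g j" for j
  proof -
    have "(a + b)\<^sup>2 \<le> 2 * a\<^sup>2 + 2 * b\<^sup>2" for a b :: real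
      using sum_squares_bound[of a b] by (simp add: power2_sum)
    then have "((u + v) \<bullet> e j)\<^sup>2 * \<bar>f (lam j)\<bar> \<le>
        (2 * (u \<bullet> e j)\<^sup>2 + 2 * (v \<bullet> e j)\<^sup>2) * (1 + (f (lam j))\<^sup>2)"
      unfolding inner_add_left by (intro mult_mono abs_le_one_plus_square) auto
    then show ?thesis by (simp add: algebra_simps abs_mult)
  qed
  ultimately show "summable (\<lambda>j. ((u + v) \<bullet> e j)\<^sup>2 * \<bar>f (lam j)\<bar>)"
    by (rule summable_comparison_test'[where N = 0])
qed

lemma spectral_form_sums:
  assumes f: "f \<in> borel_measurable borel"
    and u: "u \<in> spectral_domain H E f" and v: "v \<in> spectral_domain H E f"
  shows "(\<lambda>j. f (lam j) * (u \<bullet> e j) * (v \<bullet> e j)) sums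
    (((LINT x|scalar_measure E (u + v). f x) - (LINT x|scalar_measure E (u - v). f x)) / 4)"
proof -
  have "- v \<in> spectral_domain H E f"
    using v scale_in_H[of v "-1"] by (simp add: spectral_domain_iff f)
  from spectral_domain_sums[OF f u this] spectral_domain_sums[OF f u v]
  have "(\<lambda>j. (((u + v) \<bullet> e j)\<^sup>2 * f (lam j) - ((u - v) \<bullet> e j)\<^sup>2 * f (lam j)) / 4) sums
    (((LINT x|scalar_measure E (u + v). f x) - (LINT x|scalar_measure E (u - v). f x)) / 4)"
    by (intro sums_divide sums_diff) simp_all
  moreover have "(((u + v) \<bullet> e j)\<^sup>2 * f (lam j) - ((u - v) \<bullet> e j)\<^sup>2 * f (lam j)) / 4 =
    f (lam j) * (u \<bullet> e j) * (v \<bullet> e j)" for j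
    by (simp add: inner_add_left inner_diff_left power2_eq_square algebra_simps)
  ultimately show ?thesis by simp
qed

text \<open>Basis vectors lie in every spectral domain, having a single nonzero coefficient, so
  testing with them yields the entries. Conversely, square summability of the coefficients of v is
  precisely the domain condition on u.\<close>

lemma spectral_integral_eq:
  assumes f: "f \<in> borel_measurable borel"
  shows "spectral_integral H E f = diag_op (\<lambda>j. f (lam j))"
proof (intro equalityI subrelI)
  fix u v assume uv: "(u, v) \<in> spectral_integral H E f"
  then have u: "u \<in> spectral_domain H E f" and "v \<in> H"
    by (auto simp: spectral_integral_def)
  have dom: "e j \<in> spectral_domain H E f" for j
    unfolding spectral_domain_iff[OF f]
    using summable_finite[of "{j}" "\<lambda>i. ((e j \<bullet> e i) * f (lam i))\<^sup>2"]
    by (simp add: inner_basis)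
  show "(u, v) \<in> diag_op (\<lambda>j. f (lam j))"
  proof (rule diag_opI)
    fix i
    have "v \<bullet> e i = ((LINT x|scalar_measure E (u + e i). f x) -
        (LINT x|scalar_measure E (u - e i). f x)) / 4"
      using uv dom[of i] unfolding spectral_integral_def by blast
    then have "(\<lambda>j. f (lam j) * (u \<bullet> e j) * (e i \<bullet> e j)) sums (v \<bullet> e i)"
      using spectral_form_sums[OF f u dom[of i]] by (simp only:)
    moreover have "(\<lambda>j. f (lam j) * (u \<bullet> e j) * (e i \<bullet> e j)) sums (f (lam i) * (u \<bullet> e i))"
    proof -
      have "(\<lambda>j. f (lam j) * (u \<bullet> e j) * (e i \<bullet> e j)) =
          (\<lambda>j. if j = i then f (lam j) * (u \<bullet> e j) else 0)"
        by (auto simp: inner_basis)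
      then show ?thesis
        using sums_single[of i "\<lambda>j. f (lam j) * (u \<bullet> e j)"] by simp
    qed
    ultimately show "v \<bullet> e i = f (lam i) * (u \<bullet> e i)" by (rule sums_unique2)
  qed (use u \<open>v \<in> H\<close> in \<open>auto simp: spectral_domain_iff f\<close>)
next
  fix u v assume "(u, v) \<in> diag_op (\<lambda>j. f (lam j))"
  then have uv: "u \<in> H" "v \<in> H" "\<And>j. v \<bullet> e j = f (lam j) * (u \<bullet> e j)"
    by (auto simp: diag_op_def)
  have u: "u \<in> spectral_domain H E f"
    using summable_coef_sq[of v] uv by (simp add: spectral_domain_iff f mult.commute)
  have "v \<bullet> \<phi> = ((LINT x|scalar_measure E (u + \<phi>). f x) -
      (LINT x|scalar_measure E (u - \<phi>). f x)) / 4" if "\<phi> \<in> spectral_domain H E f" for \<phi>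
    using sums_unique2[OF parseval[OF uv(2), of \<phi>, unfolded uv(3)] spectral_form_sums[OF f u that]] .
  with u uv(2) show "(u, v) \<in> spectral_integral H E f"
    by (simp add: spectral_integral_def)
qed

end

text \<open>Chosen by its coefficients, which determine a vector of \<open>H\<close>. For u outside
  \<open>H\<close> it acts on the projection of u, so the coefficient rule holds without a side
  condition.\<close>

definition diag_pvm :: "(nat \<Rightarrow> real) \<Rightarrow> real set \<Rightarrow> 'h \<Rightarrow> 'h" where
  "diag_pvm lam S u = (SOME v. v \<in> H \<and> (\<forall>j. v \<bullet> e j = indicator S (lam j) * (u \<bullet> e j)))"

lemma diag_pvm: "diag_pvm lam S u \<in> H \<and> (\<forall>j. diag_pvm lam S u \<bullet> e j = indicator S (lam j) * (u \<bullet> e j))"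
  unfolding diag_pvm_def
proof (rule someI_ex)
  obtain v where "v \<in> H" "\<And>j. v \<bullet> e j = indicator S (lam j) * (u \<bullet> e j)"
    by (rule ex_bounded_multiple[where c = "\<lambda>j. indicator S (lam j)" and K = 1 and u = u])
      (auto simp: indicator_def)
  then show "\<exists>v. v \<in> H \<and> (\<forall>j. v \<bullet> e j = indicator S (lam j) * (u \<bullet> e j))" by blast
qed

lemma diag_pvm_in_H [simp]: "diag_pvm lam S u \<in> H"
  and diag_pvm_coef [simp]: "diag_pvm lam S u \<bullet> e j = indicator S (lam j) * (u \<bullet> e j)"
  using diag_pvm by (blast, blast)

lemma diag_pvm_basis: "diag_pvm lam S (e j) = indicator S (lam j) *\<^sub>R e j"
  by (rule eq_if_coef_eq) (auto simp: scale_in_H inner_basis)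

lemma diag_pvm_inner:
  assumes "u \<in> H" "v \<in> H"
  shows "diag_pvm lam S u \<bullet> v = u \<bullet> diag_pvm lam S v"
proof -
  have "(\<lambda>j. (diag_pvm lam S u \<bullet> e j) * (v \<bullet> e j)) = (\<lambda>j. (u \<bullet> e j) * (diag_pvm lam S v \<bullet> e j))"
    by auto
  then show ?thesis
    using parseval[OF diag_pvm_in_H] parseval[OF assms(1)] sums_unique2 by metis
qed

text \<open>Disjoint sets give orthogonal pieces whose squared norms add up to at most that of u, so
  the series converges in norm. The sum is identified by coefficients: at most one set contains
  \<open>lam j\<close>.\<close>

lemma diag_pvm_sums:
  assumes A: "disjoint_family A" and u: "u \<in> H"
  shows "(\<lambda>n. diag_pvm lam (A n) u) sums diag_pvm lam (\<Union>n. A n) u"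
proof -
  let ?x = "\<lambda>n. diag_pvm lam (A n) u"
  have disj: "indicator (A m) y * indicator (A n) y = (if m = n then indicator (A n) y else (0::real))"
    for m n y
    using A by (auto simp: disjoint_family_on_def indicator_def)
  have orth: "?x m \<bullet> ?x n = (if m = n then ?x n \<bullet> u else 0)" for m n
  proof -
    have "diag_pvm lam (A m) (?x n) = (if m = n then ?x n else 0)"
      by (rule eq_if_coef_eq) (auto simp: mult.assoc[symmetric] disj)
    then show ?thesis
      using diag_pvm_inner[OF u, of "?x n" lam "A m"] by (auto simp: inner_commute)
  qed
  have "summable ?x"
  proof (rule summable_orthogonal)
    show "?x m \<bullet> ?x n = 0" if "m \<noteq> n" for m n
      using that by (simp add: orth)
    show "summable (\<lambda>n. (norm (?x n))\<^sup>2)"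
    proof (rule summableI_nonneg_bounded)
      fix N
      define p where "p = (\<Sum>n<N. ?x n)"
      have "p \<bullet> p = (\<Sum>n<N. (norm (?x n))\<^sup>2)"
        by (simp add: p_def inner_sum_left inner_sum_right orth dot_square_norm[symmetric] cong: if_cong)
      moreover have "p \<bullet> u = p \<bullet> p"
        by (simp add: p_def inner_sum_left inner_sum_right orth cong: if_cong)
      moreover have "0 \<le> (u - p) \<bullet> (u - p)" by (rule inner_ge_zero)
      ultimately show "(\<Sum>n<N. (norm (?x n))\<^sup>2) \<le> (norm u)\<^sup>2"
        by (simp add: inner_diff_left inner_diff_right inner_commute flip: dot_square_norm)
    qed simp
  qed
  then have s: "?x sums suminf ?x" by (rule summable_sums)
  moreover have "suminf ?x = diag_pvm lam (\<Union>n. A n) u"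
  proof (rule eq_if_coef_eq)
    show "suminf ?x \<in> H" using s by (rule sums_in_H[rotated]) simp
    fix j
    have "(\<lambda>n. ?x n \<bullet> e j) sums (suminf ?x \<bullet> e j)"
      by (rule bounded_linear.sums[OF bounded_linear_inner_left s])
    moreover have "(\<lambda>n. ?x n \<bullet> e j) sums (diag_pvm lam (\<Union>n. A n) u \<bullet> e j)"
    proof (cases "\<exists>n. lam j \<in> A n")
      case True
      then obtain n where n: "lam j \<in> A n" ..
      then have "lam j \<in> A m \<longleftrightarrow> m = n" for m
        using A by (auto simp: disjoint_family_on_def)
      then show ?thesis
        using sums_single[of n "\<lambda>_. u \<bullet> e j"] n by (auto simp: indicator_def of_bool_def if_distrib[of "\<lambda>x. x * _"] cong: if_cong)
    qed (auto simp: indicator_def)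
    ultimately show "suminf ?x \<bullet> e j = diag_pvm lam (\<Union>n. A n) u \<bullet> e j"
      by (rule sums_unique2)
  qed simp
  ultimately show ?thesis by simp
qed

lemma projection_valued_measure_diag_pvm: "projection_valued_measure H (diag_pvm lam)"
proof -
  have "diag_pvm lam S (u + c *\<^sub>R v) = diag_pvm lam S u + c *\<^sub>R diag_pvm lam S v" for S u v c
    by (rule eq_if_coef_eq) (simp_all add: add_in_H scale_in_H inner_add_left distrib_left)
  moreover have "diag_pvm lam (S \<inter> T) u = diag_pvm lam S (diag_pvm lam T u)" for S T u
    by (rule eq_if_coef_eq) (simp_all add: indicator_inter_arith)
  moreover have "diag_pvm lam UNIV u = u" if "u \<in> H" for u
    by (rule eq_if_coef_eq) (simp_all add: that)
  ultimately show ?thesis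
    using diag_pvm_inner diag_pvm_sums unfolding projection_valued_measure_def by simp
qed

text \<open>The definition quantifies existentially over the spectral measure. One inclusion
  therefore treats an arbitrary one, through its action on eigenvectors; the other exhibits
  \<open>diag_pvm\<close>. The entries are arbitrary reals, so the result applies to
  \<open>A_op\<close> and to \<open>BstarB\<close> alike.\<close>

theorem functional_calculus_diag_op:
  assumes f: "f \<in> borel_measurable borel"
  shows "functional_calculus H (diag_op lam) f = diag_op (\<lambda>j. f (lam j))"
proof (intro equalityI subrelI)
  fix u v assume "(u, v) \<in> functional_calculus H (diag_op lam) f"
  then obtain E where E: "projection_valued_measure H E" "diag_op lam = spectral_integral H E (\<lambda>x. x)"
    and uv: "(u, v) \<in> spectral_integral H E f"
    unfolding functional_calculus_def is_spectral_measure_def by blast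
  interpret pvm H E
    using E(1) subspace_H by unfold_locales
  have "E S (e j) = indicator S (lam j) *\<^sub>R e j" if "S \<in> sets borel" for S j
  proof (rule eigenvector[OF _ that])
    show "(e j, lam j *\<^sub>R e j) \<in> spectral_integral H E (\<lambda>x. x)"
      unfolding E(2)[symmetric] by (rule basis_in_diag_op)
  qed
  from spectral_integral_eq[OF E(1) this f] uv show "(u, v) \<in> diag_op (\<lambda>j. f (lam j))"
    by (simp only:)
next
  fix u v assume uv: "(u, v) \<in> diag_op (\<lambda>j. f (lam j))"
  have eq: "spectral_integral H (diag_pvm lam) g = diag_op (\<lambda>j. g (lam j))"
    if "g \<in> borel_measurable borel" for g
    by (rule spectral_integral_eq[OF projection_valued_measure_diag_pvm diag_pvm_basis that])
  have "is_spectral_measure H (diag_op lam) (diag_pvm lam)"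
    using projection_valued_measure_diag_pvm[of lam] eq[of "\<lambda>x. x"]
    by (simp add: is_spectral_measure_def)
  with uv show "(u, v) \<in> functional_calculus H (diag_op lam) f"
    unfolding functional_calculus_def eq[OF f, symmetric] by blast
qed

end


section \<open>Completeness of the space of square-integrable functions\<close>

lemma square_integrable_fun_of: "square_integrable (fun_of u)"
  using Quotient3_rep_reflp[OF Quotient3_L2, of u] by (simp add: fun_of_def l2_eq_def)

lemma fun_of_measurable [measurable]: "fun_of u \<in> borel_measurable borel"
  using square_integrable_fun_of[of u] by (simp add: square_integrable_def)

lemma L2_eqI: "AE x in lborel. fun_of u x = fun_of v x \<Longrightarrow> u = v"
  using Quotient3_rel_rep[OF Quotient3_L2, of u v] square_integrable_fun_of
  by (auto simp: fun_of_def l2_eq_def)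

lemma fun_of_abs:
  assumes "square_integrable f"
  shows "AE x in lborel. fun_of (abs_L2 f) x = f x"
proof -
  have "l2_eq (rep_L2 (abs_L2 f)) f"
    using Quotient3_rel[OF Quotient3_L2, of "rep_L2 (abs_L2 f)" f] assms
      Quotient3_rep_reflp[OF Quotient3_L2] Quotient3_abs_rep[OF Quotient3_L2]
    by (auto simp: l2_eq_def)
  then show ?thesis by (simp add: l2_eq_def fun_of_def)
qed

lemma fun_of_add: "AE x in lborel. fun_of (u + v) x = fun_of u x + fun_of v x"
  using fun_of_abs[OF square_integrable_add[OF square_integrable_fun_of square_integrable_fun_of], of u v]
  by (simp add: plus_L2_def fun_of_def)

lemma fun_of_scaleR: "AE x in lborel. fun_of (c *\<^sub>R u) x = c * fun_of u x"
  using fun_of_abs[OF square_integrable_scale[OF square_integrable_fun_of], of c u]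
  by (simp add: scaleR_L2_def fun_of_def)

lemma fun_of_diff: "AE x in lborel. fun_of (u - v) x = fun_of u x - fun_of v x"
  using fun_of_add[of u "(-1) *\<^sub>R v"] fun_of_scaleR[of "-1" v] by auto

lemma inner_eq_integral: "u \<bullet> v = (LINT x|lborel. fun_of u x * fun_of v x)"
  by (simp add: inner_L2_def fun_of_def)

lemma nn_integral_fun_of:
  "(\<integral>\<^sup>+x. ennreal ((fun_of u x)\<^sup>2) \<partial>lborel) = ennreal ((norm u)\<^sup>2)"
proof -
  have "integrable lborel (\<lambda>x. (fun_of u x)\<^sup>2)"
    using square_integrable_fun_of[of u] by (simp add: square_integrable_def)
  then show ?thesis
    by (simp add: nn_integral_eq_integral inner_eq_integral flip: dot_square_norm)
      (simp add: power2_eq_square)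
qed

text \<open>The weight 2^k balances two sums: 2^k times the squared norm is at most 2^-k, and
  pointwise |y| <= 2^-k + 2^k y^2.\<close>

lemma AE_summable_fun_of:
  fixes Y :: "nat \<Rightarrow> 'a::euclidean_space L2"
  assumes Y: "\<And>k. norm (Y k) \<le> (1 / 2) ^ k"
  shows "AE x in lborel. summable (\<lambda>k. fun_of (Y k) x)"
proof -
  let ?g = "\<lambda>x. \<Sum>k. ennreal (2 ^ k * (fun_of (Y k) x)\<^sup>2)"
  have "(\<integral>\<^sup>+x. ?g x \<partial>lborel) = (\<Sum>k. \<integral>\<^sup>+x. ennreal (2 ^ k * (fun_of (Y k) x)\<^sup>2) \<partial>lborel)"
    by (rule nn_integral_suminf) measurable
  also have "\<dots> = (\<Sum>k. ennreal (2 ^ k * (norm (Y k))\<^sup>2))"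
    by (simp add: ennreal_mult' nn_integral_cmult nn_integral_fun_of)
  also have "\<dots> \<le> (\<Sum>k. ennreal ((1 / 2) ^ k))"
  proof (intro suminf_le ennreal_leI)
    fix k
    have "2 ^ k * (norm (Y k))\<^sup>2 \<le> 2 ^ k * ((1 / 2) ^ k)\<^sup>2"
      by (intro mult_left_mono power_mono Y) auto
    then show "2 ^ k * (norm (Y k))\<^sup>2 \<le> (1 / 2) ^ k"
      by (simp add: power2_eq_square power_divide)
  qed auto
  also have "\<dots> = ennreal (\<Sum>k. (1 / 2) ^ k)"
    by (intro suminf_ennreal2 summable_geometric) auto
  finally have "(\<integral>\<^sup>+x. ?g x \<partial>lborel) \<noteq> \<infinity>"
    by (auto simp: top_unique)
  then have "AE x in lborel. ?g x \<noteq> \<infinity>"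
    by (intro nn_integral_noteq_infinite) measurable
  then show ?thesis
  proof eventually_elim
    fix x assume "?g x \<noteq> \<infinity>"
    then have "summable (\<lambda>k. 2 ^ k * (fun_of (Y k) x)\<^sup>2)"
      by (intro summable_suminf_not_top) auto
    then have "summable (\<lambda>k. (1 / 2) ^ k + 2 ^ k * (fun_of (Y k) x)\<^sup>2)"
      by (intro summable_add summable_geometric) auto
    then show "summable (\<lambda>k. fun_of (Y k) x)"
    proof (rule summable_comparison_test')
      fix k :: nat
      let ?y = "fun_of (Y k) x"
      have "2 ^ k * \<bar>?y\<bar> \<le> 1 + (2 ^ k * ?y)\<^sup>2"
        using abs_le_one_plus_square[of "2 ^ k * ?y"] by (simp add: abs_mult)
      then have "2 ^ k * \<bar>?y\<bar> / 2 ^ k \<le> (1 + (2 ^ k * ?y)\<^sup>2) / 2 ^ k"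
        by (rule divide_right_mono) simp
      then show "norm ?y \<le> (1 / 2) ^ k + 2 ^ k * ?y\<^sup>2"
        by (simp add: add_divide_distrib power_divide power_mult_distrib power2_eq_square mult_ac)
    qed
  qed
qed

lemma fast_subseq:
  assumes "\<And>k. \<exists>N. \<forall>n\<ge>N. P k n"
  obtains r :: "nat \<Rightarrow> nat" where "strict_mono r" "\<And>k n. r k \<le> n \<Longrightarrow> P k n"
proof -
  obtain N where N: "\<And>k n. N k \<le> n \<Longrightarrow> P k n"
    using assms by metis
  \<comment> \<open>The partial sum dominates \<open>N k\<close>, and each \<open>Suc\<close> forces
    strict growth.\<close>
  define r where "r k = (\<Sum>i\<le>k. Suc (N i))" for k
  have "N k \<le> r k" for k
    unfolding r_def by (rule order_trans[OF _ member_le_sum[of k]]) auto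
  then have "\<And>k n. r k \<le> n \<Longrightarrow> P k n"
    using N order_trans by blast
  moreover have "strict_mono r"
    by (simp add: strict_mono_Suc_iff r_def)
  ultimately show ?thesis using that by blast
qed

text \<open>Along a fast subsequence the errors form an almost everywhere convergent series, so they
  tend to zero pointwise.\<close>

lemma tendsto_imp_AE_subseq:
  fixes X :: "nat \<Rightarrow> 'a::euclidean_space L2"
  assumes "X \<longlonglongrightarrow> u"
  obtains r :: "nat \<Rightarrow> nat" where "strict_mono r"
    "AE x in lborel. (\<lambda>k. fun_of (X (r k)) x) \<longlonglongrightarrow> fun_of u x"
proof -
  have "\<exists>N. \<forall>n\<ge>N. dist (X n) u < (1 / 2) ^ k" for k
    using assms unfolding lim_sequentially by simp
  then obtain r where r: "strict_mono r" "\<And>k n. r k \<le> n \<Longrightarrow> dist (X n) u < (1 / 2) ^ k"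
    using fast_subseq[of "\<lambda>k n. dist (X n) u < (1 / 2) ^ k"] by blast
  have "AE x in lborel. summable (\<lambda>k. fun_of (X (r k) - u) x)"
    using r(2) by (intro AE_summable_fun_of) (simp add: dist_norm less_imp_le)
  moreover have "AE x in lborel. \<forall>k. fun_of (X (r k) - u) x = fun_of (X (r k)) x - fun_of u x"
    by (simp add: AE_all_countable fun_of_diff)
  ultimately have "AE x in lborel. (\<lambda>k. fun_of (X (r k)) x) \<longlonglongrightarrow> fun_of u x"
  proof eventually_elim
    case (elim x)
    then show ?case
      using summable_LIMSEQ_zero[OF elim(1)] by (simp add: LIM_zero_iff)
  qed
  with r(1) show ?thesis by (rule that)
qed

text \<open>The limit is a bare function, not yet an element of \<open>L2\<close>; Fatou's lemma
  yields both its square integrability and its norm bound.\<close>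

lemma L2_Fatou:
  fixes Z :: "nat \<Rightarrow> 'a::euclidean_space L2"
  assumes lim: "AE x in lborel. (\<lambda>k. fun_of (Z k) x) \<longlonglongrightarrow> f x"
    and f [measurable]: "f \<in> borel_measurable borel"
    and bound: "\<And>k. N \<le> k \<Longrightarrow> norm (Z k) \<le> C"
  shows "square_integrable f" "norm (abs_L2 f) \<le> C"
proof -
  have C: "0 \<le> C" using bound[of N] norm_ge_zero[of "Z N"] by linarith
  have "(\<integral>\<^sup>+x. ennreal ((f x)\<^sup>2) \<partial>lborel) =
      (\<integral>\<^sup>+x. liminf (\<lambda>k. ennreal ((fun_of (Z k) x)\<^sup>2)) \<partial>lborel)"
  proof (rule nn_integral_cong_AE)
    show "AE x in lborel. ennreal ((f x)\<^sup>2) = liminf (\<lambda>k. ennreal ((fun_of (Z k) x)\<^sup>2))"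
      using lim
    proof eventually_elim
      case (elim x)
      then have "(\<lambda>k. ennreal ((fun_of (Z k) x)\<^sup>2)) \<longlonglongrightarrow> ennreal ((f x)\<^sup>2)"
        by (intro tendsto_ennrealI tendsto_power)
      from lim_imp_Liminf[OF _ this] show ?case by simp
    qed
  qed
  also have "\<dots> \<le> liminf (\<lambda>k. \<integral>\<^sup>+x. ennreal ((fun_of (Z k) x)\<^sup>2) \<partial>lborel)"
    by (rule nn_integral_liminf) measurable
  also have "\<dots> = liminf (\<lambda>k. ennreal ((norm (Z k))\<^sup>2))"
    by (simp add: nn_integral_fun_of)
  also have "\<dots> \<le> liminf (\<lambda>k::nat. ennreal (C\<^sup>2))"
    using bound
    by (intro Liminf_mono) (auto simp: eventually_sequentially intro!: exI[of _ N] ennreal_leI power_mono)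
  finally have le: "(\<integral>\<^sup>+x. ennreal ((f x)\<^sup>2) \<partial>lborel) \<le> ennreal (C\<^sup>2)"
    by (simp add: Liminf_const)
  then have "integrable lborel (\<lambda>x. (f x)\<^sup>2)"
    by (intro integrableI_bounded) (auto simp: less_top[symmetric] top_unique)
  then show f2: "square_integrable f"
    by (simp add: square_integrable_def)
  have "ennreal ((norm (abs_L2 f))\<^sup>2) = (\<integral>\<^sup>+x. ennreal ((f x)\<^sup>2) \<partial>lborel)"
    unfolding nn_integral_fun_of[symmetric]
    using fun_of_abs[OF f2] by (intro nn_integral_cong_AE) auto
  with le have "ennreal ((norm (abs_L2 f))\<^sup>2) \<le> ennreal (C\<^sup>2)" by simp
  then have "(norm (abs_L2 f))\<^sup>2 \<le> C\<^sup>2" by (simp add: ennreal_le_iff)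
  then show "norm (abs_L2 f) \<le> C"
    using C by (rule power2_le_imp_le)
qed

text \<open>Riesz-Fischer: a fast subsequence converges almost everywhere to f, and Fatou along it,
  with n fixed, bounds the distance from \<open>X n\<close> to f.\<close>

instance L2 :: (euclidean_space) complete_space
proof
  fix X :: "nat \<Rightarrow> 'a L2" assume "Cauchy X"
  then have X: "\<exists>N. \<forall>n\<ge>N. \<forall>m\<ge>N. dist (X n) (X m) < \<epsilon>" if "0 < \<epsilon>" for \<epsilon>
    using that unfolding Cauchy_def by blast
  have "\<exists>N. \<forall>n\<ge>N. \<forall>m\<ge>n. dist (X n) (X m) < (1 / 2) ^ k" for k
    using X[of "(1 / 2) ^ k"] by (meson le_trans zero_less_divide_1_iff zero_less_numeral zero_less_power)
  then obtain r where r: "strict_mono r"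
    "\<And>k n. r k \<le> n \<Longrightarrow> \<forall>m\<ge>n. dist (X n) (X m) < (1 / 2) ^ k"
    using fast_subseq[of "\<lambda>k n. \<forall>m\<ge>n. dist (X n) (X m) < (1 / 2) ^ k"] by blast
  \<comment> \<open>Where the sequence diverges \<open>lim\<close> is a default value; f stays
    measurable and those points form a null set.\<close>
  define f where "f x = lim (\<lambda>k. fun_of (X (r k)) x)" for x
  have [measurable]: "f \<in> borel_measurable borel"
    unfolding f_def by (rule borel_measurable_lim_metric) measurable
  have "AE x in lborel. summable (\<lambda>k. fun_of (X (r (Suc k)) - X (r k)) x)"
  proof (rule AE_summable_fun_of)
    fix k
    have "r k \<le> r (Suc k)" using r(1) by (simp add: strict_mono_less_eq)
    with r(2)[of k "r k"] show "norm (X (r (Suc k)) - X (r k)) \<le> (1 / 2) ^ k"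
      by (auto simp: dist_norm norm_minus_commute less_imp_le)
  qed
  moreover have "AE x in lborel. \<forall>k. fun_of (X (r (Suc k)) - X (r k)) x =
      fun_of (X (r (Suc k))) x - fun_of (X (r k)) x"
    by (simp add: AE_all_countable fun_of_diff)
  ultimately have lim: "AE x in lborel. (\<lambda>k. fun_of (X (r k)) x) \<longlonglongrightarrow> f x"
  proof eventually_elim
    case (elim x)
    then have "convergent (\<lambda>n. \<Sum>k<n. fun_of (X (r (Suc k))) x - fun_of (X (r k)) x)"
      by (simp add: summable_iff_convergent)
    then have "convergent (\<lambda>n. fun_of (X (r n)) x - fun_of (X (r 0)) x)"
      by (simp add: sum_lessThan_telescope[of "\<lambda>k. fun_of (X (r k)) x"])
    from convergent_add[OF this convergent_const[of "fun_of (X (r 0)) x"]]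
    show ?case by (simp add: f_def convergent_LIMSEQ_iff)
  qed
  have lim_diff: "AE x in lborel. (\<lambda>k. fun_of (X n - X (r k)) x) \<longlonglongrightarrow> fun_of (X n) x - f x" for n
  proof -
    have "AE x in lborel. \<forall>k. fun_of (X n - X (r k)) x = fun_of (X n) x - fun_of (X (r k)) x"
      by (simp add: AE_all_countable fun_of_diff)
    with lim show ?thesis
      by eventually_elim (auto intro: tendsto_diff)
  qed
  have bound: "\<exists>N. \<forall>n\<ge>N. square_integrable (\<lambda>x. fun_of (X n) x - f x) \<and>
      norm (abs_L2 (\<lambda>x. fun_of (X n) x - f x)) \<le> \<epsilon>" if \<epsilon>: "0 < \<epsilon>" for \<epsilon>
  proof -
    obtain N where N: "\<forall>n\<ge>N. \<forall>m\<ge>N. dist (X n) (X m) < \<epsilon>" using X[OF \<epsilon>] by blast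
    have "norm (X n - X (r k)) \<le> \<epsilon>" if "N \<le> n" "N \<le> k" for n k
      using N that strict_mono_imp_increasing[OF r(1), of k] by (auto simp: dist_norm less_imp_le)
    then have "square_integrable (\<lambda>x. fun_of (X n) x - f x) \<and>
        norm (abs_L2 (\<lambda>x. fun_of (X n) x - f x)) \<le> \<epsilon>" if "N \<le> n" for n
      using L2_Fatou[OF lim_diff[of n], of N \<epsilon>] that by auto
    then show ?thesis by blast
  qed
  obtain n where "square_integrable (\<lambda>x. fun_of (X n) x - f x)"
    using bound[of 1] by auto
  from square_integrable_add[OF square_integrable_fun_of[of "X n"] square_integrable_scale[OF this, of "-1"]]
  have f: "square_integrable f" by simp
  have "X n - abs_L2 f = abs_L2 (\<lambda>x. fun_of (X n) x - f x)"
    if "square_integrable (\<lambda>x. fun_of (X n) x - f x)" for n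
    using fun_of_diff[of "X n" "abs_L2 f"] fun_of_abs[OF f] fun_of_abs[OF that]
    by (intro L2_eqI) auto
  then have "\<exists>N. \<forall>n\<ge>N. norm (X n - abs_L2 f) \<le> \<epsilon>" if "0 < \<epsilon>" for \<epsilon>
    using bound[OF that] by metis
  then have "X \<longlonglongrightarrow> abs_L2 f"
    unfolding LIMSEQ_iff by (meson field_lbound_gt_zero le_less_trans)
  then show "convergent X" by (auto simp: convergent_def)
qed

instance L2 :: (euclidean_space) banach ..


section \<open>The form of the fractional Laplacian\<close>

text \<open>Half of the exponent N + 2s, so that the product of two quotients carries the full
  kernel and the seminorm becomes an \<open>L2\<close> norm. On the diagonal the value is 0.\<close>

definition difference_quotient :: "real \<Rightarrow> ('a::euclidean_space \<Rightarrow> real) \<Rightarrow> 'a \<times> 'a \<Rightarrow> real" where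
  "difference_quotient s f z =
     (f (fst z) - f (snd z)) / norm (fst z - snd z) powr (real DIM('a) / 2 + s)"

definition gagliardo :: "real \<Rightarrow> 'a::euclidean_space L2 \<Rightarrow> ('a \<times> 'a) L2" where
  "gagliardo s u = abs_L2 (difference_quotient s (fun_of u))"

lemma difference_quotient_measurable [measurable]:
  assumes [measurable]: "f \<in> borel_measurable borel"
  shows "difference_quotient s f \<in> borel_measurable borel"
  unfolding difference_quotient_def borel_prod[symmetric] by measurable

lemma difference_quotient_mult:
  fixes f g :: "'a::euclidean_space \<Rightarrow> real"
  shows "difference_quotient s f (x, y) * difference_quotient s g (x, y) =
    (f x - f y) * (g x - g y) / norm (x - y) powr (real DIM('a) + 2 * s)"
proof -
  have "norm (x - y) powr (real DIM('a) + 2 * s) =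
      norm (x - y) powr (real DIM('a) / 2 + s) * norm (x - y) powr (real DIM('a) / 2 + s)"
    by (simp add: powr_add[symmetric])
  then show ?thesis by (simp add: difference_quotient_def)
qed

lemma sobolev_iff: "u \<in> sobolev s \<longleftrightarrow> square_integrable (difference_quotient s (fun_of u))"
proof -
  have "(\<lambda>(x, y). (fun_of u x - fun_of u y)\<^sup>2 / norm (x - y) powr (real DIM('a) + 2 * s)) =
      (\<lambda>z. (difference_quotient s (fun_of u) z)\<^sup>2)"
    by (auto simp: power2_eq_square difference_quotient_mult)
  then show ?thesis
    by (simp add: sobolev_def square_integrable_def lborel_prod)
qed

lemma fun_of_gagliardo:
  "u \<in> sobolev s \<Longrightarrow> AE z in lborel. fun_of (gagliardo s u) z = difference_quotient s (fun_of u) z"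
  unfolding gagliardo_def sobolev_iff by (rule fun_of_abs)

text \<open>Strips over a null set are null in the product. This transfers almost everywhere
  identities for functions to their difference quotients.\<close>

lemma AE_lborel_fst_snd:
  fixes P :: "'a::euclidean_space \<Rightarrow> bool"
  assumes "AE x in lborel. P x"
  shows "AE z in lborel. P (fst z) \<and> P (snd z)"
proof -
  obtain N where N: "{x. \<not> P x} \<subseteq> N" "N \<in> null_sets lborel"
    using assms by (auto elim!: AE_E simp: null_sets_def)
  then have "N \<times> (UNIV :: 'a set) \<in> null_sets (lborel \<Otimes>\<^sub>M lborel)"
    "(UNIV :: 'a set) \<times> N \<in> null_sets (lborel \<Otimes>\<^sub>M lborel)"
    by (auto simp: null_sets_def lborel.emeasure_pair_measure_Times)
  then have "N \<times> UNIV \<union> UNIV \<times> N \<in> null_sets (lborel :: ('a \<times> 'a) measure)"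
    unfolding lborel_prod by (rule null_sets.Un)
  then show ?thesis
    by (rule AE_I') (use N(1) in auto)
qed

lemma gagliardo_add_scaleR:
  assumes u: "u \<in> sobolev s" and v: "v \<in> sobolev s"
  shows "u + c *\<^sub>R v \<in> sobolev s"
    and "gagliardo s (u + c *\<^sub>R v) = gagliardo s u + c *\<^sub>R gagliardo s v"
proof -
  let ?q = "\<lambda>w. difference_quotient s (fun_of w)"
  have "AE x in lborel. fun_of (u + c *\<^sub>R v) x = fun_of u x + c * fun_of v x"
    using fun_of_add[of u "c *\<^sub>R v"] fun_of_scaleR[of c v] by eventually_elim simp
  from AE_lborel_fst_snd[OF this]
  have q: "AE z in lborel. ?q (u + c *\<^sub>R v) z = ?q u z + c * ?q v z"
    by eventually_elim
      (simp add: difference_quotient_def add_divide_distrib[symmetric] algebra_simps)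
  have "square_integrable (\<lambda>z. ?q u z + c * ?q v z)"
    using u v by (intro square_integrable_add square_integrable_scale) (auto simp: sobolev_iff)
  then have "integrable lborel (\<lambda>z. (?q u z + c * ?q v z)\<^sup>2)"
    by (simp add: square_integrable_def)
  then have "integrable lborel (\<lambda>z. (?q (u + c *\<^sub>R v) z)\<^sup>2)"
    by (rule Bochner_Integration.integrable_cong_AE_imp) (use q in auto)
  then show uv: "u + c *\<^sub>R v \<in> sobolev s"
    by (simp add: sobolev_iff square_integrable_def)
  show "gagliardo s (u + c *\<^sub>R v) = gagliardo s u + c *\<^sub>R gagliardo s v"
  proof (rule L2_eqI)
    show "AE z in lborel. fun_of (gagliardo s (u + c *\<^sub>R v)) z =
        fun_of (gagliardo s u + c *\<^sub>R gagliardo s v) z"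
      using q fun_of_gagliardo[OF uv] fun_of_gagliardo[OF u] fun_of_gagliardo[OF v]
        fun_of_add[of "gagliardo s u" "c *\<^sub>R gagliardo s v"] fun_of_scaleR[of c "gagliardo s v"]
      by eventually_elim simp
  qed
qed

lemma zero_in_sobolev: "(0 :: 'a::euclidean_space L2) \<in> sobolev s"
  and gagliardo_zero: "gagliardo s (0 :: 'a L2) = 0"
proof -
  have "AE x in lborel. fun_of (0 :: 'a L2) x = 0"
    using fun_of_scaleR[of 0 "0 :: 'a L2"] by simp
  from AE_lborel_fst_snd[OF this]
  have q: "AE z in lborel. difference_quotient s (fun_of (0 :: 'a L2)) z = 0"
    by eventually_elim (simp add: difference_quotient_def)
  have "integrable lborel (\<lambda>z. (difference_quotient s (fun_of (0 :: 'a L2)) z)\<^sup>2)"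
    by (rule Bochner_Integration.integrable_cong_AE_imp[OF integrable_zero]) (use q in auto)
  then show zero: "(0 :: 'a L2) \<in> sobolev s"
    by (simp add: sobolev_iff square_integrable_def)
  show "gagliardo s (0 :: 'a L2) = 0"
    using gagliardo_add_scaleR(2)[OF zero zero, of 1] by simp
qed

lemma gagliardo_sum:
  fixes x :: "nat \<Rightarrow> 'a::euclidean_space L2"
  assumes "\<And>j. x j \<in> sobolev s"
  shows "(\<Sum>j<n. c j *\<^sub>R x j) \<in> sobolev s \<and>
    gagliardo s (\<Sum>j<n. c j *\<^sub>R x j) = (\<Sum>j<n. c j *\<^sub>R gagliardo s (x j))"
  by (induction n) (simp_all add: zero_in_sobolev gagliardo_zero gagliardo_add_scaleR assms)

text \<open>Two nested subsequences make the functions and then their quotients converge almost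
  everywhere. A quotient depends continuously on the two function values, so its pointwise limit is
  both the quotient of u and g.\<close>

lemma gagliardo_closed:
  assumes X: "\<And>n. X n \<in> sobolev s" "X \<longlonglongrightarrow> u" and g: "(\<lambda>n. gagliardo s (X n)) \<longlonglongrightarrow> g"
  shows "u \<in> sobolev s" "gagliardo s u = g"
proof -
  let ?q = "\<lambda>w. difference_quotient s (fun_of w)"
  obtain r where r: "strict_mono r" "AE x in lborel. (\<lambda>k. fun_of (X (r k)) x) \<longlonglongrightarrow> fun_of u x"
    using tendsto_imp_AE_subseq[OF X(2)] .
  have "(\<lambda>k. gagliardo s (X (r k))) \<longlonglongrightarrow> g"
    using LIMSEQ_subseq_LIMSEQ[OF g r(1)] by (simp add: comp_def)
  then obtain r' where r': "strict_mono r'"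
    "AE z in lborel. (\<lambda>k. fun_of (gagliardo s (X (r (r' k)))) z) \<longlonglongrightarrow> fun_of g z"
    by (rule tendsto_imp_AE_subseq)
  have "AE z in lborel. \<forall>k. fun_of (gagliardo s (X (r (r' k)))) z = ?q (X (r (r' k))) z"
    by (simp add: AE_all_countable fun_of_gagliardo X(1))
  then have q: "AE z in lborel. ?q u z = fun_of g z"
    using AE_lborel_fst_snd[OF r(2)] r'(2)
  proof eventually_elim
    case (elim z)
    have "(\<lambda>k. ?q (X (r k)) z) \<longlonglongrightarrow> ?q u z"
      unfolding difference_quotient_def divide_inverse
      using elim(2) by (intro tendsto_intros) auto
    then have "(\<lambda>k. ?q (X (r (r' k))) z) \<longlonglongrightarrow> ?q u z"
      using LIMSEQ_subseq_LIMSEQ[OF _ r'(1)] by (fastforce simp: comp_def)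
    with elim(1,3) show ?case
      using LIMSEQ_unique by auto
  qed
  have "integrable lborel (\<lambda>z. (fun_of g z)\<^sup>2)"
    using square_integrable_fun_of[of g] by (simp add: square_integrable_def)
  then have "integrable lborel (\<lambda>z. (?q u z)\<^sup>2)"
    by (rule Bochner_Integration.integrable_cong_AE_imp) (use q in auto)
  then show u: "u \<in> sobolev s"
    by (simp add: sobolev_iff square_integrable_def)
  show "gagliardo s u = g"
    using q fun_of_gagliardo[OF u] by (intro L2_eqI) (auto elim: AE_mp)
qed

lemma frac_form_eq:
  fixes u v :: "'a::euclidean_space L2"
  assumes "u \<in> sobolev0 s \<Omega>" "v \<in> sobolev0 s \<Omega>"
    and \<Omega>: "open \<Omega>"
  shows "frac_form s \<Omega> u v =
    u \<bullet> v + frac_laplacian_const DIM('a) s / 2 * (gagliardo s u \<bullet> gagliardo s v)"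
proof -
  have uv: "u \<in> sobolev s" "v \<in> sobolev s" "u \<in> L2_on \<Omega>"
    using assms by (auto simp: sobolev0_def)
  have [measurable]: "\<Omega> \<in> sets borel" using \<Omega> by simp
  have "(LINT x:\<Omega>|lborel. fun_of u x * fun_of v x) = u \<bullet> v"
    unfolding set_lebesgue_integral_def inner_eq_integral
  proof (rule integral_cong_AE)
    have "AE x in lborel. x \<notin> \<Omega> \<longrightarrow> fun_of u x = 0"
      using uv(3) by (simp add: L2_on_def)
    then show "AE x in lborel. indicator \<Omega> x *\<^sub>R (fun_of u x * fun_of v x) = fun_of u x * fun_of v x"
      by eventually_elim (auto simp: indicator_def)
  qed measurable
  moreover have "(LINT (x, y)|(lborel \<Otimes>\<^sub>M lborel). (fun_of u x - fun_of u y) *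
      (fun_of v x - fun_of v y) / norm (x - y) powr (real DIM('a) + 2 * s)) =
    gagliardo s u \<bullet> gagliardo s v"
  proof -
    have "(\<lambda>(x, y). (fun_of u x - fun_of u y) * (fun_of v x - fun_of v y) /
        norm (x - y) powr (real DIM('a) + 2 * s)) =
      (\<lambda>z. difference_quotient s (fun_of u) z * difference_quotient s (fun_of v) z)"
      by (auto simp: difference_quotient_mult)
    moreover have "(LINT z|lborel. difference_quotient s (fun_of u) z * difference_quotient s (fun_of v) z) =
        gagliardo s u \<bullet> gagliardo s v"
      unfolding inner_eq_integral
      using fun_of_gagliardo[OF uv(1)] fun_of_gagliardo[OF uv(2)]
      by (intro integral_cong_AE) auto
    ultimately show ?thesis by (simp add: lborel_prod)
  qed
  ultimately show ?thesis by (simp add: frac_form_def)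
qed

lemma frac_laplacian_const_pos: "0 < s \<Longrightarrow> s < 1 \<Longrightarrow> 0 < frac_laplacian_const N s"
  by (auto simp: frac_laplacian_const_def intro!: divide_pos_pos mult_pos_pos Gamma_real_pos add_nonneg_pos)

section \<open>Identification of the form operator with its diagonal model\<close>

lemma (in hilbert_basis) sums_diag_op:
  assumes "(u, f) \<in> diag_op lam" "v \<in> H"
  shows "(\<lambda>j. lam j * (u \<bullet> e j) * (v \<bullet> e j)) sums (f \<bullet> v)"
  using parseval[of f v] assms by (simp add: diag_op_def)

text \<open>Subtracting the \<open>L2\<close> part from the eigenvalue equation leaves
  \<open>lam j - 1\<close>, whence the quotients of the \<open>e j\<close> are orthogonal. For (u,
  f) in the diagonal operator the series of quotients then converges, and closedness makes its sum
  the quotient of u.\<close>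

lemma A_op_eq_diag_op:
  fixes \<Omega> :: "'a::euclidean_space set"
  assumes \<Omega>: "open \<Omega>" and s: "0 < s" "s < 1"
    and basis: "orthonormal_basis (L2_on \<Omega>) e"
    and eig: "\<And>j. (e j, lam j *\<^sub>R e j) \<in> A_op s \<Omega>"
  shows "A_op s \<Omega> = hilbert_basis.diag_op (L2_on \<Omega>) e lam"
proof -
  let ?D = "gagliardo s"
  define c where "c = frac_laplacian_const DIM('a) s / 2"
  have c: "0 < c" using frac_laplacian_const_pos[OF s] by (simp add: c_def)
  interpret hilbert_basis "L2_on \<Omega>" e
    by unfold_locales (rule basis)
  have e: "e j \<in> sobolev0 s \<Omega>" and eig_form: "v \<in> sobolev0 s \<Omega> \<Longrightarrow> frac_form s \<Omega> (e j) v = lam j * (e j \<bullet> v)"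
    for j v
    using eig[of j] by (auto simp: A_op_def form_operator_def)
  have form: "frac_form s \<Omega> u v = u \<bullet> v + c * (?D u \<bullet> ?D v)"
    if "u \<in> sobolev0 s \<Omega>" "v \<in> sobolev0 s \<Omega>" for u v
    unfolding c_def by (rule frac_form_eq[OF that \<Omega>])
  have De: "c * (?D (e j) \<bullet> ?D v) = (lam j - 1) * (e j \<bullet> v)" if "v \<in> sobolev0 s \<Omega>" for j v
    using eig_form[OF that, of j] form[OF e that, of j] by (simp add: algebra_simps)
  show ?thesis
  proof (intro equalityI subrelI)
    fix u f assume uf: "(u, f) \<in> A_op s \<Omega>"
    then have u: "u \<in> sobolev0 s \<Omega>" "f \<in> L2_on \<Omega>"
      by (auto simp: A_op_def form_operator_def)
    show "(u, f) \<in> diag_op lam"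
    proof (rule diag_opI)
      fix j
      have "f \<bullet> e j = frac_form s \<Omega> u (e j)"
        using uf e[of j] by (simp add: A_op_def form_operator_def)
      also have "\<dots> = frac_form s \<Omega> (e j) u"
        by (simp add: form u e inner_commute)
      finally show "f \<bullet> e j = lam j * (u \<bullet> e j)"
        by (simp add: eig_form u inner_commute)
    qed (use u in \<open>auto simp: sobolev0_def\<close>)
  next
    fix u f assume uf: "(u, f) \<in> diag_op lam"
    then have u: "u \<in> L2_on \<Omega>" "f \<in> L2_on \<Omega>" by (auto simp: diag_op_def)
    define y where "y j = (u \<bullet> e j) *\<^sub>R ?D (e j)" for j
    have De_e: "?D (e i) \<bullet> ?D (e j) = (if i = j then (lam j - 1) / c else 0)" for i j
      using De[OF e, of i j] c by (auto simp: inner_basis field_simps)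
    have "summable y"
    proof (rule summable_orthogonal)
      show "y i \<bullet> y j = 0" if "i \<noteq> j" for i j
        using that by (simp add: y_def De_e)
      \<comment> \<open>The squared norm is \<open>(lam j - 1) / c\<close> times the squared
        coefficient; it is summable by Parseval for f against u and for u against itself.\<close>
      have "(norm (y j))\<^sup>2 = (lam j * (u \<bullet> e j) * (u \<bullet> e j) - (u \<bullet> e j) * (u \<bullet> e j)) / c" for j
        unfolding power2_norm_eq_inner by (simp add: y_def De_e field_simps)
      moreover have "summable (\<lambda>j. (lam j * (u \<bullet> e j) * (u \<bullet> e j) - (u \<bullet> e j) * (u \<bullet> e j)) / c)"
        using sums_diag_op[OF uf u(1)] parseval[OF u(1), of u]
        by (intro summable_divide summable_diff) (auto simp: sums_iff)
      ultimately show "summable (\<lambda>j. (norm (y j))\<^sup>2)" by simp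
    qed
    then have y: "y sums suminf y" by (rule summable_sums)
    have es: "e j \<in> sobolev s" for j using e[of j] by (simp add: sobolev0_def)
    have Du: "u \<in> sobolev s" "?D u = suminf y"
      using gagliardo_closed[of "\<lambda>n. \<Sum>j<n. (u \<bullet> e j) *\<^sub>R e j" s u "suminf y"]
        gagliardo_sum[of e s "\<lambda>j. u \<bullet> e j"] es expansion[OF u(1)] y
      by (simp_all add: sums_def y_def)
    then have u0: "u \<in> sobolev0 s \<Omega>" using u(1) by (simp add: sobolev0_def)
    have "frac_form s \<Omega> u v = f \<bullet> v" if v: "v \<in> sobolev0 s \<Omega>" for v
    proof -
      have vH: "v \<in> L2_on \<Omega>" using v by (simp add: sobolev0_def)
      have "(\<lambda>j. (u \<bullet> e j) * (v \<bullet> e j) + c * (y j \<bullet> ?D v)) sums (u \<bullet> v + c * (?D u \<bullet> ?D v))"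
        unfolding Du(2)
        by (intro sums_add sums_mult parseval u bounded_linear.sums[OF bounded_linear_inner_left y])
      \<comment> \<open>The 1 from the \<open>L2\<close> part and \<open>lam j - 1\<close> from the
        seminorm recombine to \<open>lam j\<close>.\<close>
      moreover have "(u \<bullet> e j) * (v \<bullet> e j) + c * (y j \<bullet> ?D v) = lam j * (u \<bullet> e j) * (v \<bullet> e j)" for j
      proof -
        have "c * (y j \<bullet> ?D v) = (u \<bullet> e j) * (c * (?D (e j) \<bullet> ?D v))"
          by (simp add: y_def)
        then show ?thesis
          by (simp add: De[OF v] inner_commute[of "e j" v] algebra_simps)
      qed
      ultimately have "u \<bullet> v + c * (?D u \<bullet> ?D v) = f \<bullet> v"
        using sums_diag_op[OF uf vH] sums_unique2 by (simp add: sums_iff)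
      then show ?thesis by (simp add: form[OF u0 v])
    qed
    then show "(u, f) \<in> A_op s \<Omega>"
      using u0 u(2) by (simp add: A_op_def form_operator_def)
  qed
qed


section \<open>The source condition\<close>

theorem proposition4p6:
  fixes \<Omega> :: "'a::euclidean_space set"
    and s t \<beta> :: real
    and u w :: "'a L2"
    and e :: "nat \<Rightarrow> 'a L2"
    and lam uc wc :: "nat \<Rightarrow> real"
  assumes "bounded_lipschitz_domain \<Omega>"
    and "0 < s" "s < 1" "0 < t" "0 < \<beta>" "\<beta> \<le> 1"
    and "u \<in> sobolev0 s \<Omega>"
    and "orthonormal_basis (L2_on \<Omega>) e"
    and "\<And>j. (e j, lam j *\<^sub>R e j) \<in> A_op s \<Omega>"
    and "1 \<le> lam 0" "mono lam" "filterlim lam at_top sequentially"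
    and "(\<lambda>j. uc j *\<^sub>R e j) sums u"
    and "w \<in> L2_on \<Omega>"
    and "(\<lambda>j. wc j *\<^sub>R e j) sums w"
  shows "(source_condition s t \<Omega> \<beta> u w \<longleftrightarrow>
            (\<forall>j. uc j = lam j powr (- (\<beta> + 1 / 2)) * exp (- 2 * \<beta> * t * lam j) * wc j))
         \<and> (\<lambda>j. (wc j)\<^sup>2) sums (norm w)\<^sup>2"
proof -
  let ?H = "L2_on \<Omega>"
  interpret hilbert_basis ?H e
    by unfold_locales (rule assms(8))
  \<comment> \<open>Indices start at 0, so \<open>lam 0\<close> is the smallest eigenvalue.\<close>
  have lam: "1 \<le> lam j" for j
    using assms(10) monoD[OF assms(11), of 0 j] by simp
  have uH: "u \<in> ?H" using assms(7) by (simp add: sobolev0_def)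
  have uc: "u \<bullet> e j = uc j" and wc: "w \<bullet> e j = wc j" for j
    using coef_of_sums assms(13,15) by auto
  have A: "A_op s \<Omega> = diag_op lam"
    by (rule A_op_eq_diag_op) (use assms in \<open>auto simp: bounded_lipschitz_domain_def\<close>)
  have pow: "op_power ?H (diag_op c) p = diag_op (\<lambda>j. c j powr p)" for c p
    unfolding op_power_def by (rule functional_calculus_diag_op) measurable
  have semigroup: "op_semigroup ?H (diag_op c) t = diag_op (\<lambda>j. exp (- t * c j))" for c
    unfolding op_semigroup_def by (rule functional_calculus_diag_op) measurable
  define b where "b j = lam j powr (- 1 / 2) * exp (- t * lam j)" for j
  have pow_le: "lam j powr (- 1 / 2) \<le> 1" for j
    using powr_mono[of "- 1 / 2" 0 "lam j"] lam[of j] by simp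
  have exp_le: "exp (- t * lam j) \<le> 1" for j
    using lam[of j] assms(4) by simp
  have b: "0 < b j" "b j \<le> 1" for j
    using lam[of j] pow_le[of j] exp_le[of j] by (auto simp: b_def intro!: mult_le_one)
  have B: "B_op s t \<Omega> = diag_op b"
    unfolding B_op_def A pow semigroup b_def
    by (rule diag_op_comp[where K = 1]) (use pow_le in simp)
  have BB: "BstarB s t \<Omega> = diag_op (\<lambda>j. b j * b j)"
    unfolding BstarB_def B adjoint_diag_op
    by (rule diag_op_comp[where K = 1]) (use b in \<open>simp add: less_imp_le\<close>)
  have b_powr: "(b j * b j) powr \<beta> = lam j powr (- \<beta>) * exp (- 2 * \<beta> * t * lam j)" for j
  proof -
    have "b j * b j = lam j powr (- 1) * exp (- 2 * t * lam j)"
    proof -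
      have "lam j powr (- 1 / 2) * lam j powr (- 1 / 2) = lam j powr (- 1)"
        by (simp add: powr_add[symmetric])
      moreover have "exp (- t * lam j) * exp (- t * lam j) = exp (- 2 * t * lam j)"
        by (simp add: exp_add[symmetric])
      ultimately show ?thesis unfolding b_def by (metis mult.assoc mult.left_commute)
    qed
    moreover have "(lam j powr (- 1) * exp (- 2 * t * lam j)) powr \<beta> =
        (lam j powr (- 1)) powr \<beta> * exp (- 2 * t * lam j) powr \<beta>"
      by (rule powr_mult)
    ultimately show ?thesis
      by (simp only: powr_powr exp_powr_real) (simp add: mult_ac)
  qed
  have cond: "source_condition s t \<Omega> \<beta> u w \<longleftrightarrow>
      (\<exists>z\<in>?H. \<forall>j. z \<bullet> e j = lam j powr (1 / 2) * uc j \<and> z \<bullet> e j = (b j * b j) powr \<beta> * wc j)"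
    unfolding source_condition_def A BB pow
    using uH assms(14) by (auto simp: diag_op_def uc wc)
  \<comment> \<open>Cancelling the nonzero factor \<open>lam j powr (1 / 2)\<close> shifts the
    exponent from -\<beta> to -(\<beta> + 1/2).\<close>
  have coef_iff: "lam j powr (1 / 2) * uc j = (b j * b j) powr \<beta> * wc j \<longleftrightarrow>
      uc j = lam j powr (- (\<beta> + 1 / 2)) * exp (- 2 * \<beta> * t * lam j) * wc j" for j
  proof -
    have "lam j powr (- \<beta>) = lam j powr (1 / 2) * lam j powr (- (\<beta> + 1 / 2))"
      by (simp add: powr_add[symmetric])
    moreover have "lam j powr (1 / 2) \<noteq> 0" using lam[of j] by simp
    ultimately show ?thesis unfolding b_powr by (simp add: mult.assoc)
  qed
  \<comment> \<open>The coefficient identities alone name no vector; multiplying the coefficients of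
    w by numbers in [0, 1] provides one.\<close>
  have ex_z: "\<exists>z\<in>?H. \<forall>j. z \<bullet> e j = (b j * b j) powr \<beta> * wc j"
  proof -
    have "\<bar>(b j * b j) powr \<beta>\<bar> \<le> 1" for j
      using b[of j] assms(5) by (simp add: powr_le1 mult_le_one)
    then obtain z where "z \<in> ?H" "\<And>j. z \<bullet> e j = (b j * b j) powr \<beta> * (w \<bullet> e j)"
      by (rule ex_bounded_multiple[where u = w and c = "\<lambda>j. (b j * b j) powr \<beta>"]) blast
    then show ?thesis unfolding wc by blast
  qed
  have "source_condition s t \<Omega> \<beta> u w \<longleftrightarrow>
      (\<forall>j. lam j powr (1 / 2) * uc j = (b j * b j) powr \<beta> * wc j)"
    unfolding cond using ex_z by metis
  moreover have "(\<lambda>j. (wc j)\<^sup>2) sums (norm w)\<^sup>2"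
    using parseval[OF assms(14), of w] by (simp add: wc dot_square_norm power2_eq_square[symmetric])
  ultimately show ?thesis by (simp only: coef_iff simp_thms)
qed

end
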